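(* Let $V:\mathbb{R}\to\mathbb{R}$ satisfy Assumption (V) of the context. Let $\bar x>0$ be fixed and let $$\Omega=\big\{(s,x,w,z)\in\mathbb{R}^4:\ s\in(-1,1),\ x\in(0,\bar x],\ V(f^{-1}(s))\,x^2+w^2+z^2=1\big\}.$$ Then every collapsing scalar field in the case $\kappa=-1$ (as defined in the context) with initial data $(s(0),x(0),w(0),z(0))\in\Omega$ remains in $\Omega$ for every $\tau\ge0$, and generically (with respect to the initial data in $\Omega$) it approaches, as $\tau\to+\infty$, the set $M_{-1}\subseteq\overline\Omega\setminus\Omega$ defined by $$M_{-1}=\overline\Omega\cap\big(\{|s|=1\}\cup\{w^2+z^2=1\}\big)\cap\{x=0\},$$ where $\overline\Omega$ is the closure of $\Omega$ in $\mathbb{R}^4$. In particular, generically $$\lim_{\tau\to\infty}x(\tau)=0^+.$$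
   Context: **Compactification.** $f:\mathbb{R}\to(-1,1)$ is a fixed strictly increasing $C^2$ bijection with $f'>0$ and $$\lim_{\phi\to-\infty}\frac{f''(\phi)}{f'(\phi)}=\lambda_->0,\qquad \lim_{\phi\to+\infty}\frac{f''(\phi)}{f'(\phi)}=\lambda_+<0.$$ The variable $s=f(\phi)$ replaces the scalar field $\phi$. The function $s\mapsto f'(f^{-1}(s))$ is extended by continuity by the value $0$ at $s=\pm1$. Set $$u(s)=\frac{V'(f^{-1}(s))}{\sqrt6\,V(f^{-1}(s))}$$ wherever $V(f^{-1}(s))\neq 0$. **Assumption (V).** $V:\mathbb{R}\to\mathbb{R}$ is of class $C^2$ and: (1) $V(\phi)>0$ for all $|\phi|$ sufficiently large, $V'(\phi)<0$ for all $\phi$ sufficiently close to $-\infty$, and $V'(\phi)>0$ for all $\phi$ sufficiently close to $+\infty$; (2) the limits $u(-1):=\lim_{s\to-1}u(s)$ and $u(1):=\lim_{s\to1}u(s)$ exist and are finite. **Cutoff.** Fix $\delta>0$ such that $V(f^{-1}(s))>0$ and $V'(f^{-1}(s))\ne0$ for all $s\in(-1,-1+\delta)\cup(1-\delta,1)$, and a smooth function $\psi:[-1,1]\to[0,1]$ with $\psi(s)=1$ if $|s|\le1-\delta$ and $\psi(s)=0$ if $|s|\in(1-\delta/2,1]$. **Collapsing scalar field in the case $\kappa=-1$.** A solution $\tau\mapsto(s(\tau),x(\tau),w(\tau),z(\tau))$ of $$\frac{ds}{d\tau}=f'(f^{-1}(s))\,w,\qquad \frac{dx}{d\tau}=-\frac{x}{\sqrt6}(3w^2+z^2),$$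 $$\frac{dw}{d\tau}=(1-\psi(s))\,\theta_1(s,w,z)+\psi(s)\,\theta_2(s,x,w,z),\qquad \frac{dz}{d\tau}=\frac{z}{\sqrt6}(1-3w^2-z^2),$$ where $$\theta_1(s,w,z)=\sqrt{\tfrac32}\Big[w\big(1-w^2-\tfrac13z^2\big)-u(s)\big(1-w^2-z^2\big)\Big],$$ $$\theta_2(s,x,w,z)=\sqrt{\tfrac32}\,w\big(1-w^2-\tfrac13z^2\big)-\tfrac12V'(f^{-1}(s))\,x^2,$$ with initial data satisfying $x(0)>0$ and the (flow-invariant) constraint $V(f^{-1}(s))x^2+w^2+z^2=1$. (The term $(1-\psi)\theta_1$ is read as $0$ where $\psi=1$.) **Conventions.** A solution approaches a set $M$ if its distance to $M$ tends to $0$ as $\tau\to+\infty$. "Generically" refers to small perturbations of the initial data: a property holds generically if it is stable under sufficiently small perturbations of the initial data, and initial data for which it fails can be turned into data for which it holds by arbitrarily small perturbations; i.e. the set of initial data (in the set of admissible data, here $\Omega$ with the topology induced from $\mathbb{R}^4$) for which the property holds is open and dense.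
   Formalization: The constraint is required along the whole solution, not only at τ=0; its flow-invariance is proved when (1−ψ)u is bounded on (−1,1). If V vanishes extremely fast at |s|=1−δ, solutions of the equations alone can leave the constraint, so the literal claim fails there. *)

theory Defs
  imports "HOL-Analysis.Analysis"
begin

definition C2_real :: "(real \<Rightarrow> real) \<Rightarrow> bool" where
  "C2_real g \<longleftrightarrow>
     (\<forall>t. g differentiable (at t)) \<and>
     (\<forall>t. deriv g differentiable (at t)) \<and>
     continuous_on UNIV (deriv (deriv g))"

text \<open>Smoothness on a set with one-sided derivatives at boundary points: \<open>D k\<close> is the
  \<open>k\<close>-th derivative relative to \<open>S\<close>.\<close>

definition smooth_within :: "real set \<Rightarrow> (real \<Rightarrow> real) \<Rightarrow> bool" where
  "smooth_within S g \<longleftrightarrow>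
     (\<exists>D :: nat \<Rightarrow> real \<Rightarrow> real.
        (\<forall>s\<in>S. D 0 s = g s) \<and>
        (\<forall>k. \<forall>s\<in>S. (D k has_real_derivative D (Suc k) s) (at s within S)))"

definition compactification :: "(real \<Rightarrow> real) \<Rightarrow> bool" where
  "compactification f \<longleftrightarrow>
     strict_mono f \<and> bij_betw f UNIV {-1<..<1} \<and> C2_real f \<and>
     (\<forall>\<phi>. deriv f \<phi> > 0) \<and>
     (\<exists>lm>0. ((\<lambda>\<phi>. deriv (deriv f) \<phi> / deriv f \<phi>) \<longlongrightarrow> lm) at_bot) \<and>
     (\<exists>lp<0. ((\<lambda>\<phi>. deriv (deriv f) \<phi> / deriv f \<phi>) \<longlongrightarrow> lp) at_top)"

definition speed_ext :: "(real \<Rightarrow> real) \<Rightarrow> real \<Rightarrow> real" where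
  "speed_ext f s = (if \<bar>s\<bar> < 1 then deriv f (inv f s) else 0)"

definition u_int :: "(real \<Rightarrow> real) \<Rightarrow> (real \<Rightarrow> real) \<Rightarrow> real \<Rightarrow> real" where
  "u_int f V s = deriv V (inv f s) / (sqrt 6 * V (inv f s))"

text \<open>Where \<open>V\<close> vanishes, \<open>u_int\<close> is \<open>0\<close> by the convention for division by zero. This value is
  irrelevant: it enters the vector field below only through \<open>(1 - \<psi> s) * theta1\<close>, and
  \<open>\<psi> s = 1\<close> at such points.\<close>

definition u_ext :: "(real \<Rightarrow> real) \<Rightarrow> (real \<Rightarrow> real) \<Rightarrow> real \<Rightarrow> real" where
  "u_ext f V s =
     (if \<bar>s\<bar> < 1 then u_int f V s
      else if s \<le> -1 then Lim (at_right (-1)) (u_int f V)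
      else Lim (at_left 1) (u_int f V))"

definition assumption_V :: "(real \<Rightarrow> real) \<Rightarrow> (real \<Rightarrow> real) \<Rightarrow> bool" where
  "assumption_V f V \<longleftrightarrow>
     C2_real V \<and>
     (\<forall>\<^sub>F \<phi> in at_bot. V \<phi> > 0 \<and> deriv V \<phi> < 0) \<and>
     (\<forall>\<^sub>F \<phi> in at_top. V \<phi> > 0 \<and> deriv V \<phi> > 0) \<and>
     (\<exists>l. (u_int f V \<longlongrightarrow> l) (at_right (-1))) \<and>
     (\<exists>l. (u_int f V \<longlongrightarrow> l) (at_left 1))"

definition cutoff :: "(real \<Rightarrow> real) \<Rightarrow> (real \<Rightarrow> real) \<Rightarrow> real \<Rightarrow> (real \<Rightarrow> real) \<Rightarrow> bool" where
  "cutoff f V \<delta> \<psi> \<longleftrightarrow>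
     \<delta> > 0 \<and>
     (\<forall>s \<in> {-1<..<-1+\<delta>} \<union> {1-\<delta><..<1}. V (inv f s) > 0 \<and> deriv V (inv f s) \<noteq> 0) \<and>
     smooth_within {-1..1} \<psi> \<and>
     (\<forall>s\<in>{-1..1}. 0 \<le> \<psi> s \<and> \<psi> s \<le> 1) \<and>
     (\<forall>s\<in>{-1..1}. \<bar>s\<bar> \<le> 1 - \<delta> \<longrightarrow> \<psi> s = 1) \<and>
     (\<forall>s\<in>{-1..1}. \<bar>s\<bar> > 1 - \<delta> / 2 \<longrightarrow> \<psi> s = 0)"

type_synonym state = "real \<times> real \<times> real \<times> real"

definition theta1 :: "(real \<Rightarrow> real) \<Rightarrow> (real \<Rightarrow> real) \<Rightarrow> real \<Rightarrow> real \<Rightarrow> real \<Rightarrow> real" where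
  "theta1 f V s w z =
     sqrt (3/2) * (w * (1 - w\<^sup>2 - z\<^sup>2 / 3) - u_ext f V s * (1 - w\<^sup>2 - z\<^sup>2))"

definition theta2 :: "(real \<Rightarrow> real) \<Rightarrow> (real \<Rightarrow> real) \<Rightarrow> real \<Rightarrow> real \<Rightarrow> real \<Rightarrow> real \<Rightarrow> real" where
  "theta2 f V s x w z =
     sqrt (3/2) * w * (1 - w\<^sup>2 - z\<^sup>2 / 3) - 1/2 * deriv V (inv f s) * x\<^sup>2"

text \<open>At \<open>s = -1\<close> and \<open>s = 1\<close> the term \<open>inv f s\<close> in \<open>theta2\<close> is meaningless, but there
  \<open>\<psi> s = 0\<close>.\<close>

definition vec_field :: "(real \<Rightarrow> real) \<Rightarrow> (real \<Rightarrow> real) \<Rightarrow> (real \<Rightarrow> real) \<Rightarrow> state \<Rightarrow> state" where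
  "vec_field f V \<psi> = (\<lambda>(s, x, w, z).
     (speed_ext f s * w,
      - (x / sqrt 6) * (3 * w\<^sup>2 + z\<^sup>2),
      (1 - \<psi> s) * theta1 f V s w z + \<psi> s * theta2 f V s x w z,
      z / sqrt 6 * (1 - 3 * w\<^sup>2 - z\<^sup>2)))"

text \<open>Solutions on \<open>[0,T)\<close>, where \<open>T\<close> may be infinite. The state space is the one on which the
  (extended) vector field is given, \<open>s \<in> [-1,1]\<close>; that \<open>s\<close> stays in the open interval is not
  built in.\<close>

definition solution_on ::
  "(real \<Rightarrow> real) \<Rightarrow> (real \<Rightarrow> real) \<Rightarrow> (real \<Rightarrow> real) \<Rightarrow> ereal \<Rightarrow> (real \<Rightarrow> state) \<Rightarrow> bool" where
  "solution_on f V \<psi> T \<gamma> \<longleftrightarrow>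
     (\<forall>\<tau> \<in> {\<tau>. 0 \<le> \<tau> \<and> ereal \<tau> < T}.
        fst (\<gamma> \<tau>) \<in> {-1..1} \<and>
        (\<gamma> has_vector_derivative vec_field f V \<psi> (\<gamma> \<tau>)) (at \<tau> within {\<tau>. 0 \<le> \<tau> \<and> ereal \<tau> < T}))"

definition admissible :: "(real \<Rightarrow> real) \<Rightarrow> (real \<Rightarrow> real) \<Rightarrow> state set" where
  "admissible f V = {(s, x, w, z). -1 < s \<and> s < 1 \<and> x > 0 \<and> V (inv f s) * x\<^sup>2 + w\<^sup>2 + z\<^sup>2 = 1}"

text \<open>The constraint is only meaningful for \<open>\<bar>s\<bar> < 1\<close>.\<close>

definition constraint_set :: "(real \<Rightarrow> real) \<Rightarrow> (real \<Rightarrow> real) \<Rightarrow> state set" where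
  "constraint_set f V = {(s, x, w, z). \<bar>s\<bar> < 1 \<longrightarrow> V (inv f s) * x\<^sup>2 + w\<^sup>2 + z\<^sup>2 = 1}"

text \<open>The flow-invariant constraint is read as part of the system. On the constraint set
  \<open>theta1\<close> and \<open>theta2\<close> agree wherever \<open>V > 0\<close> and \<open>\<bar>s\<bar> < 1\<close>. Off it the defect
  \<open>E = V x\<^sup>2 + w\<^sup>2 + z\<^sup>2 - 1\<close> obeys a linear equation whose coefficient contains
  \<open>w * (1 - \<psi> s) * u s\<close>. This is unbounded if \<open>V\<close> vanishes so fast at an edge
  \<open>\<bar>s\<bar> = 1 - \<delta>\<close> that \<open>1 - \<psi>\<close> does not compensate, and \<open>E\<close> may then leave \<open>0\<close> there,
  the vector field being discontinuous. If \<open>cutoff_regular\<close> holds, imposing the constraint at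
  \<open>\<tau> = 0\<close> or at all times is the same.\<close>

definition constrained_solution_on ::
  "(real \<Rightarrow> real) \<Rightarrow> (real \<Rightarrow> real) \<Rightarrow> (real \<Rightarrow> real) \<Rightarrow> ereal \<Rightarrow> (real \<Rightarrow> state) \<Rightarrow> bool" where
  "constrained_solution_on f V \<psi> T \<gamma> \<longleftrightarrow>
     solution_on f V \<psi> T \<gamma> \<and>
     (\<forall>\<tau>. 0 \<le> \<tau> \<and> ereal \<tau> < T \<longrightarrow> \<gamma> \<tau> \<in> constraint_set f V)"

definition cutoff_regular :: "(real \<Rightarrow> real) \<Rightarrow> (real \<Rightarrow> real) \<Rightarrow> (real \<Rightarrow> real) \<Rightarrow> bool" where
  "cutoff_regular f V \<psi> \<longleftrightarrow> bounded ((\<lambda>s. (1 - \<psi> s) * u_int f V s) ` {-1<..<1})"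

text \<open>A collapsing scalar field (for \<open>\<kappa> = -1\<close>) is a forward solution with admissible initial
  data, considered on its maximal interval of existence \<open>[0,T)\<close>. Global existence is thus
  expressed by \<open>T = \<infinity>\<close>.\<close>

definition collapsing_field ::
  "(real \<Rightarrow> real) \<Rightarrow> (real \<Rightarrow> real) \<Rightarrow> (real \<Rightarrow> real) \<Rightarrow> ereal \<Rightarrow> (real \<Rightarrow> state) \<Rightarrow> bool" where
  "collapsing_field f V \<psi> T \<gamma> \<longleftrightarrow>
     0 < T \<and> constrained_solution_on f V \<psi> T \<gamma> \<and> \<gamma> 0 \<in> admissible f V \<and>
     (\<forall>T' \<eta>. T \<le> T' \<and> constrained_solution_on f V \<psi> T' \<eta> \<and>
        (\<forall>\<tau>. 0 \<le> \<tau> \<and> ereal \<tau> < T \<longrightarrow> \<eta> \<tau> = \<gamma> \<tau>) \<longrightarrow> T' = T)"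

definition Omega :: "(real \<Rightarrow> real) \<Rightarrow> (real \<Rightarrow> real) \<Rightarrow> real \<Rightarrow> state set" where
  "Omega f V xbar =
     {(s, x, w, z). s \<in> {-1<..<1} \<and> x \<in> {0<..xbar} \<and> V (inv f s) * x\<^sup>2 + w\<^sup>2 + z\<^sup>2 = 1}"

definition M_minus1 :: "(real \<Rightarrow> real) \<Rightarrow> (real \<Rightarrow> real) \<Rightarrow> real \<Rightarrow> state set" where
  "M_minus1 f V xbar =
     closure (Omega f V xbar)
       \<inter> ({(s, x, w, z). \<bar>s\<bar> = 1} \<union> {(s, x, w, z). w\<^sup>2 + z\<^sup>2 = 1})
       \<inter> {(s, x, w, z). x = 0}"

text \<open>The nonemptiness clause is there because \<open>infdist\<close> to the empty set is \<open>0\<close>.\<close>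

definition approaches :: "(real \<Rightarrow> 'a::metric_space) \<Rightarrow> 'a set \<Rightarrow> bool" where
  "approaches \<gamma> M \<longleftrightarrow> M \<noteq> {} \<and> ((\<lambda>\<tau>. infdist (\<gamma> \<tau>) M) \<longlongrightarrow> 0) at_top"

definition generically :: "'a::topological_space set \<Rightarrow> ('a \<Rightarrow> bool) \<Rightarrow> bool" where
  "generically A P \<longleftrightarrow>
     openin (top_of_set A) {p\<in>A. P p} \<and> A \<subseteq> closure {p\<in>A. P p}"

end

theory Submission
  imports Defs
begin

text \<open>In the coordinate \<open>\<phi>\<close> with \<open>s = f \<phi>\<close> the constrained system reads \<open>\<phi>' = w\<close> together with polynomial
  equations whose only coefficient function is \<open>V'\<close>. Since \<open>V\<close> is bounded below and \<open>x\<close>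
  decreases, the constraint bounds \<open>w\<close> and \<open>z\<close>, so \<open>\<phi>\<close> grows at most linearly and solutions are
  global and unique; in particular \<open>s\<close> never reaches \<open>\<plusminus>1\<close>. By compactness, approaching \<open>M\<^sub>-\<^sub>1\<close> is
  the same as \<open>x \<rightarrow> 0\<close>. If \<open>z(0) \<noteq> 0\<close>, then \<open>z / x\<close> is a constant times \<open>exp (\<tau> / \<surd>6)\<close> while \<open>z\<close> is
  bounded, so \<open>x \<rightarrow> 0\<close>; this gives density. For openness, there is a threshold \<open>\<xi>\<close> such that
  \<open>x(\<tau>) < \<xi>\<close> at a single time already forces \<open>x \<rightarrow> 0\<close>, and that is an open condition on the initial
  data.\<close>

subsection \<open>Ordinary differential equations\<close>

text \<open>Decay of \<open>x\<close> can fail: at a critical point of \<open>V\<close> with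
  \<open>V > 0\<close>, the state \<open>w = z = 0\<close>, \<open>x = 1 / sqrt V\<close> is
  stationary. What can be excluded is a positive limit \<open>l\<close> of \<open>x\<close> that is
  too small. Such a limit leaves \<open>x\<close> only a finite total decrease, which together with
  a bound on the derivative of \<open>w\<close> forces \<open>w\<close> to tend to 0. If
  \<open>z\<close> vanishes, the constraint then makes \<open>V\<close> tend to
  \<open>1 / l\<^sup>2\<close>. Critical points of \<open>V\<close> lie in a bounded interval, so
  above a suitable level \<open>K\<close> the slope of \<open>V\<close> at a given level is bounded
  away from 0, and \<open>w\<close> could not settle. This gives the threshold
  \<open>1 / sqrt K\<close>. The obstacle is that \<open>\<phi>\<close> may run off to infinity, so
  \<open>V\<close> and its derivative need not stay bounded along a solution. The finite limits of
  \<open>u\<close> repair this: the derivative is at most \<open>C * (1 + \<bar>V\<bar>)\<close>,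
  and \<open>V * x\<^sup>2\<close> is bounded through the constraint. The cutoff field may be
  discontinuous, so existence and uniqueness are never proved for it directly. For
  \<open>\<bar>s\<bar> < 1\<close> it is the field in \<open>\<phi>\<close> plus a multiple of the
  constraint defect.\<close>

lemma gronwall_real:
  fixes e :: "real \<Rightarrow> real"
  assumes deriv: "\<And>t. t \<in> {a..b} \<Longrightarrow> (e has_real_derivative d t) (at t within {a..b})"
    and le: "\<And>t. t \<in> {a..b} \<Longrightarrow> d t \<le> c * e t"
    and t: "t \<in> {a..b}"
  shows "e t \<le> e a * exp (c * (t - a))"
proof -
  \<comment> \<open>The integrating factor turns the inequality into monotonicity of
    \<open>h\<close>, whatever the signs of \<open>e\<close> and \<open>c\<close>;
    \<open>linear_ode_bounds\<close> applies this to minus a square with a rate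
    \<open>- 2 * K\<close>.\<close>
  define h where "h = (\<lambda>t. e t * exp (- c * (t - a)))"
  have hd: "(h has_real_derivative (d s - c * e s) * exp (- c * (s - a))) (at s within {a..b})"
    if "s \<in> {a..b}" for s
    unfolding h_def
    by (rule derivative_eq_intros deriv[OF that] refl)+ (simp add: algebra_simps)
  have "h t \<le> h a"
  proof (rule DERIV_nonpos_imp_decreasing_open[where f = h])
    show "a \<le> t" using t by simp
    show "\<exists>y. (h has_real_derivative y) (at s) \<and> y \<le> 0" if "a < s" "s < t" for s
    proof (intro exI conjI)
      have s: "s \<in> {a..b}" "s \<in> {a<..<b}" using that t by auto
      show "(h has_real_derivative (d s - c * e s) * exp (- c * (s - a))) (at s)"
        using hd[OF s(1)] s(2) by (simp add: at_within_Icc_at)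
      show "(d s - c * e s) * exp (- c * (s - a)) \<le> 0"
        using le[OF s(1)] by (simp add: mult_nonpos_nonneg)
    qed
    have "continuous_on {a..b} h"
      using hd by (meson DERIV_continuous continuous_on_eq_continuous_within)
    then show "continuous_on {a..t} h"
      by (rule continuous_on_subset) (use t in auto)
  qed
  then have "e t * exp (- c * (t - a)) * exp (c * (t - a)) \<le> e a * exp (c * (t - a))"
    by (simp add: h_def)
  then show ?thesis
    by (simp add: mult.assoc flip: exp_add)
qed

text \<open>The square of \<open>e\<close> solves a linear equation with rate \<open>2 * k\<close>,
  so it lies between two exponentials. The upper one propagates zero; the lower one keeps
  \<open>e\<close> off zero, and the intermediate value theorem then fixes the sign. Only a bound on
  \<open>k\<close> is asked, because in \<open>admissible_invariant\<close> the coefficient contains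
  \<open>(1 - \<psi> s) * u_int f V s\<close>, of which only boundedness is known.\<close>

lemma linear_ode_bounds:
  fixes e :: "real \<Rightarrow> real"
  assumes deriv: "\<And>t. t \<in> {a..b} \<Longrightarrow> (e has_real_derivative k t * e t) (at t within {a..b})"
    and le: "\<And>t. t \<in> {a..b} \<Longrightarrow> \<bar>k t\<bar> \<le> K"
    and t: "t \<in> {a..b}"
  shows "e a = 0 \<Longrightarrow> e t = 0" "e a > 0 \<Longrightarrow> e t > 0"
proof -
  have sq: "((\<lambda>t. (e t)\<^sup>2) has_real_derivative 2 * k t * (e t)\<^sup>2) (at t within {a..b})"
    if "t \<in> {a..b}" for t
    by (rule derivative_eq_intros deriv[OF that] refl)+ (simp add: power2_eq_square)
  have up: "(e s)\<^sup>2 \<le> (e a)\<^sup>2 * exp (2 * K * (s - a))" if "s \<in> {a..b}" for s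
  proof (rule gronwall_real[OF sq _ that])
    show "2 * k t * (e t)\<^sup>2 \<le> 2 * K * (e t)\<^sup>2" if "t \<in> {a..b}" for t
      using le[OF that] by (intro mult_right_mono) auto
  qed
  show "e t = 0" if "e a = 0"
    using up[OF t] that by simp
  show "e t > 0" if pos: "e a > 0"
  proof -
    have nz: "e s \<noteq> 0" if s: "s \<in> {a..b}" for s
    proof -
      have "- (e s)\<^sup>2 \<le> - (e a)\<^sup>2 * exp ((- 2 * K) * (s - a))"
      proof (rule gronwall_real[OF DERIV_minus[OF sq] _ s])
        show "- (2 * k t * (e t)\<^sup>2) \<le> - 2 * K * - (e t)\<^sup>2" if "t \<in> {a..b}" for t
        proof -
          have "(- K) * (e t)\<^sup>2 \<le> k t * (e t)\<^sup>2"
            using le[OF that] by (intro mult_right_mono) auto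
          then show ?thesis by simp
        qed
      qed
      moreover have "(e a)\<^sup>2 * exp ((- 2 * K) * (s - a)) > 0" using pos by simp
      ultimately show ?thesis by auto
    qed
    have cont: "continuous_on {a..t} e"
      using deriv t
      by (meson DERIV_continuous continuous_on_eq_continuous_within continuous_on_subset
          atLeastatMost_subset_iff atLeastAtMost_iff order_refl)
    show ?thesis
    proof (rule ccontr)
      assume "\<not> e t > 0"
      then obtain s where "s \<ge> a" "s \<le> t" "e s = 0"
        using IVT2'[of e t 0 a] cont pos t by auto
      then show False using nz[of s] t by auto
    qed
  qed
qed

text \<open>The times outside the open set form a compact set, so a violation would have a first
  time, which \<open>step\<close> rules out. At \<open>t = a\<close> the premise about earlier times
  is empty, so every use has to treat the initial time separately.\<close>

lemma first_exit:
  fixes y :: "real \<Rightarrow> 'a::topological_space"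
  assumes cont: "continuous_on {a..b} y" and "open S"
    and step: "\<And>t. t \<in> {a..b} \<Longrightarrow> (\<And>s. a \<le> s \<Longrightarrow> s < t \<Longrightarrow> y s \<in> S) \<Longrightarrow> y t \<in> S"
    and t: "t \<in> {a..b}"
  shows "y t \<in> S"
proof (rule ccontr)
  assume nt: "y t \<notin> S"
  define A where "A = {a..b} \<inter> y -` (- S)"
  have "closed A"
    unfolding A_def using \<open>open S\<close>
    by (intro continuous_closed_preimage cont) auto
  then have "compact A"
    unfolding A_def by (metis compact_Icc compact_Int_closed inf.idem inf_assoc)
  moreover have "A \<noteq> {}" using nt t by (auto simp: A_def)
  ultimately obtain m where m: "m \<in> A" "\<And>s. s \<in> A \<Longrightarrow> m \<le> s"
    using compact_attains_inf[of A] by metis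
  have "y m \<in> S"
  proof (rule step)
    show "m \<in> {a..b}" using m by (simp add: A_def)
    show "y s \<in> S" if "a \<le> s" "s < m" for s
      using m that by (force simp: A_def)
  qed
  then show False using m by (simp add: A_def)
qed

lemma has_vector_derivative_imp_continuous_on:
  assumes "\<And>t. t \<in> S \<Longrightarrow> (y has_vector_derivative y' t) (at t within S)"
  shows "continuous_on S y"
  using assms by (meson continuous_on_eq_continuous_within has_vector_derivative_continuous)

text \<open>Gronwall is applied to the squared distance, which is differentiable even where the two
  solutions meet; its rate is \<open>2 * L\<close> by Cauchy-Schwarz.\<close>

lemma ode_solutions_dist:
  fixes g h :: "real \<Rightarrow> 'a::real_inner"
  assumes lip: "L-lipschitz_on K F"
    and g: "\<And>t. t \<in> {a..b} \<Longrightarrow> (g has_vector_derivative F (g t)) (at t within {a..b})"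
      "\<And>t. t \<in> {a..b} \<Longrightarrow> g t \<in> K"
    and h: "\<And>t. t \<in> {a..b} \<Longrightarrow> (h has_vector_derivative F (h t)) (at t within {a..b})"
      "\<And>t. t \<in> {a..b} \<Longrightarrow> h t \<in> K"
    and t: "t \<in> {a..b}"
  shows "dist (g t) (h t) \<le> exp (L * (t - a)) * dist (g a) (h a)"
proof -
  define e where "e t = (norm (g t - h t))\<^sup>2" for t
  define d where "d t = 2 * ((g t - h t) \<bullet> (F (g t) - F (h t)))" for t
  have "e t \<le> e a * exp (2 * L * (t - a))"
  proof (rule gronwall_real[OF _ _ t])
    fix s assume s: "s \<in> {a..b}"
    have "((\<lambda>t. g t - h t) has_derivative (\<lambda>r. r *\<^sub>R (F (g s) - F (h s)))) (at s within {a..b})"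
      using has_vector_derivative_diff[OF g(1)[OF s] h(1)[OF s]]
      by (simp add: has_vector_derivative_def)
    from has_derivative_inner[OF this this]
    show "(e has_real_derivative d s) (at s within {a..b})"
      unfolding has_field_derivative_def e_def d_def power2_norm_eq_inner
      by (rule has_derivative_eq_rhs) (auto simp: algebra_simps inner_commute)
    have "d s \<le> 2 * (norm (g s - h s) * norm (F (g s) - F (h s)))"
      unfolding d_def by (intro mult_left_mono norm_cauchy_schwarz) auto
    also have "\<dots> \<le> 2 * (norm (g s - h s) * (L * norm (g s - h s)))"
      using lipschitz_on_normD[OF lip g(2)[OF s] h(2)[OF s]]
      by (intro mult_left_mono) auto
    finally show "d s \<le> 2 * L * e s"
      by (simp add: e_def power2_eq_square mult_ac)
  qed
  also have "\<dots> = (exp (L * (t - a)) * norm (g a - h a))\<^sup>2"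
    by (simp add: e_def power_mult_distrib mult.commute flip: exp_double)
  finally have "(norm (g t - h t))\<^sup>2 \<le> (exp (L * (t - a)) * norm (g a - h a))\<^sup>2"
    by (simp add: e_def)
  then show ?thesis
    by (metis dist_norm power2_le_imp_le mult_nonneg_nonneg exp_ge_zero norm_ge_zero)
qed

text \<open>Bielecki's weighted norm: the unknown is \<open>exp (- c * t) *\<^sub>R y t\<close>
  instead of \<open>y\<close>, which makes the Picard operator a contraction on an interval of any
  length, so a single use of Banach's theorem suffices.\<close>

theorem picard_lipschitz:
  fixes F :: "'a::euclidean_space \<Rightarrow> 'a"
  assumes lip: "L-lipschitz_on UNIV F" and N: "0 \<le> N"
  shows "\<exists>y. y 0 = x0 \<and> (\<forall>t\<in>{0..N}. (y has_vector_derivative F (y t)) (at t within {0..N}))"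
proof -
  \<comment> \<open>This choice gives \<open>L / c \<le> 1/2\<close>, the contraction factor, and
    keeps \<open>c\<close> positive for \<open>L = 0\<close>.\<close>
  define c where "c = 2 * L + 1"
  have L: "0 \<le> L" using lip by (rule lipschitz_on_nonneg)
  have c: "c > 0" using L by (simp add: c_def)
  have contF: "continuous_on UNIV F" using lip by (rule lipschitz_on_continuous_on)
  \<comment> \<open>Freezing time outside \<open>{0..N}\<close> makes the iterates bounded and
    continuous on the whole line, so that they live in the complete space
    \<open>real \<Rightarrow>\<^sub>C 'a\<close>.\<close>
  define cl where "cl t = max 0 (min N t)" for t :: real
  have cl: "cl t \<in> {0..N}" for t using N by (simp add: cl_def)
  have contcl: "continuous_on UNIV cl" unfolding cl_def by (intro continuous_intros)
  define G where "G u s = F (exp (c * s) *\<^sub>R apply_bcontfun u s)" for u :: "real \<Rightarrow>\<^sub>C 'a" and s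
  have contG: "continuous_on S (G u)" for u S
    unfolding G_def
    by (rule continuous_on_compose2[OF contF]) (auto intro!: continuous_intros)
  have intG: "G u integrable_on {0..t}" for u t
    by (rule integrable_continuous_interval[OF contG])
  define Q where "Q u t = exp (- c * t) *\<^sub>R (x0 + integral {0..t} (G u))" for u t
  have contQ: "continuous_on {0..N} (Q u)" for u
    unfolding Q_def by (intro continuous_intros indefinite_integral_continuous_1 intG)
  define P where "P u = Bcontfun (\<lambda>t. Q u (cl t))" for u
  have P: "apply_bcontfun (P u) t = Q u (cl t)" for u t
  proof -
    have "continuous_on UNIV (\<lambda>t. Q u (cl t))"
      by (rule continuous_on_compose2[OF contQ contcl]) (use cl in auto)
    moreover have "bounded (range (\<lambda>t. Q u (cl t)))"
      by (rule bounded_subset[OF compact_imp_bounded[OF compact_continuous_image[OF contQ compact_Icc]]])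
        (use cl in auto)
    ultimately have "(\<lambda>t. Q u (cl t)) \<in> bcontfun" by (simp add: bcontfun_def)
    then show ?thesis by (simp add: P_def Bcontfun_inverse)
  qed
  have contr: "dist (P u) (P v) \<le> 1/2 * dist u v" for u v
  proof (rule dist_bound)
    fix t' define t where "t = cl t'"
    have t: "t \<in> {0..N}" unfolding t_def by (rule cl)
    define D where "D = dist u v"
    have hi: "((\<lambda>s. L * D * exp (c * s)) has_integral (L * D / c * exp (c * t) - L * D / c * exp (c * 0))) {0..t}"
    proof (rule fundamental_theorem_of_calculus)
      show "0 \<le> t" using t by simp
      fix s assume "s \<in> {0..t}"
      have "((\<lambda>s. L * D / c * exp (c * s)) has_real_derivative L * D * exp (c * s)) (at s within {0..t})"
        by (rule derivative_eq_intros refl)+ (use c in auto)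
      then show "((\<lambda>s. L * D / c * exp (c * s)) has_vector_derivative L * D * exp (c * s)) (at s within {0..t})"
        by (simp add: has_real_derivative_iff_has_vector_derivative)
    qed
    have "norm (integral {0..t} (\<lambda>s. G u s - G v s)) \<le> integral {0..t} (\<lambda>s. L * D * exp (c * s))"
    proof (rule integral_norm_bound_integral)
      show "(\<lambda>s. G u s - G v s) integrable_on {0..t}" by (intro integrable_diff intG)
      show "(\<lambda>s. L * D * exp (c * s)) integrable_on {0..t}" using hi by blast
      fix s
      have "norm (G u s - G v s) \<le> L * norm (exp (c * s) *\<^sub>R u s - exp (c * s) *\<^sub>R v s)"
        unfolding G_def by (rule lipschitz_on_normD[OF lip]) auto
      also have "\<dots> = L * (exp (c * s) * dist (u s) (v s))"
        by (simp add: dist_norm flip: scaleR_diff_right)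
      also have "\<dots> \<le> L * (exp (c * s) * D)"
        unfolding D_def by (intro mult_left_mono dist_bounded L) auto
      finally show "norm (G u s - G v s) \<le> L * D * exp (c * s)" by (simp add: mult_ac)
    qed
    also have "\<dots> = L * D / c * exp (c * t) - L * D / c * exp (c * 0)"
      using hi by (rule integral_unique)
    also have "\<dots> \<le> 1/2 * D * exp (c * t)"
    proof -
      have "L / c \<le> 1/2" using c by (simp add: c_def field_simps)
      then have "L / c * (D * exp (c * t)) \<le> 1/2 * (D * exp (c * t))"
        by (rule mult_right_mono) (simp add: D_def)
      moreover have "0 \<le> L * D / c" using L c by (simp add: D_def)
      ultimately show ?thesis by simp
    qed
    finally have *: "norm (integral {0..t} (\<lambda>s. G u s - G v s)) \<le> 1/2 * D * exp (c * t)" .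
    have "dist (P u t') (P v t') = norm (exp (- c * t) *\<^sub>R integral {0..t} (\<lambda>s. G u s - G v s))"
      by (simp add: P Q_def dist_norm integral_diff[OF intG intG] flip: t_def scaleR_diff_right)
    also have "\<dots> = exp (- c * t) * norm (integral {0..t} (\<lambda>s. G u s - G v s))" by simp
    also have "\<dots> \<le> exp (- c * t) * (1/2 * D * exp (c * t))"
      using * by (intro mult_left_mono) auto
    also have "\<dots> = 1/2 * D" by (simp add: exp_minus)
    finally show "dist (P u t') (P v t') \<le> 1/2 * dist u v" by (simp add: D_def)
  qed
  obtain u where u: "P u = u"
    using banach_fix_type[of "1/2" P] contr by auto
  define y where "y t = x0 + integral {0..t} (G u)" for t
  have Gy: "G u t = F (y t)" if "t \<in> {0..N}" for t
  proof -
    have "u t = exp (- c * t) *\<^sub>R y t"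
      using P[of u t] that by (simp add: u Q_def y_def cl_def)
    then have "exp (c * t) *\<^sub>R u t = y t" by (simp flip: exp_add)
    then show ?thesis by (simp add: G_def)
  qed
  have "(y has_vector_derivative F (y t)) (at t within {0..N})" if "t \<in> {0..N}" for t
    using has_vector_derivative_add[OF has_vector_derivative_const[of x0]
        integral_has_vector_derivative[OF contG[of _ u] that]]
    by (simp add: Gy[OF that] flip: y_def)
  moreover have "y 0 = x0" by (simp add: y_def)
  ultimately show ?thesis by blast
qed

section \<open>Bounds from compactness and componentwise derivatives\<close>

lemma compact_abs_bound:
  fixes k :: "'a::topological_space \<Rightarrow> real"
  assumes "compact S" "continuous_on S k"
  obtains K where "\<And>s. s \<in> S \<Longrightarrow> \<bar>k s\<bar> \<le> K"
  using compact_imp_bounded[OF compact_continuous_image[OF assms(2,1)]]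
  by (auto simp: bounded_iff)

lemma linear_ode_continuous_bounds:
  fixes e k :: "real \<Rightarrow> real"
  assumes deriv: "\<And>t. t \<in> {a..b} \<Longrightarrow> (e has_real_derivative k t * e t) (at t within {a..b})"
    and cont: "continuous_on {a..b} k"
    and t: "t \<in> {a..b}"
  shows "e a = 0 \<Longrightarrow> e t = 0" "e a > 0 \<Longrightarrow> e t > 0"
proof -
  obtain K where K: "\<And>s. s \<in> {a..b} \<Longrightarrow> \<bar>k s\<bar> \<le> K"
    using compact_abs_bound[OF compact_Icc cont] by blast
  show "e a = 0 \<Longrightarrow> e t = 0" "e a > 0 \<Longrightarrow> e t > 0"
    using linear_ode_bounds[OF deriv K t] by blast+
qed

lemma lipschitz_mult_compact:
  fixes g h :: "'a::metric_space \<Rightarrow> real"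
  assumes "compact S" and g: "\<exists>L. L-lipschitz_on S g" and h: "\<exists>L. L-lipschitz_on S h"
  shows "\<exists>L. L-lipschitz_on S (\<lambda>p. g p * h p)"
proof -
  obtain L M where L: "L-lipschitz_on S g" and M: "M-lipschitz_on S h" using g h by blast
  have "bounded (g ` S)" "bounded (h ` S)"
    using \<open>compact S\<close> L M
    by (auto intro!: compact_imp_bounded compact_continuous_image lipschitz_on_continuous_on)
  then obtain A B where A: "\<And>p. p \<in> S \<Longrightarrow> \<bar>g p\<bar> \<le> A" and B: "\<And>p. p \<in> S \<Longrightarrow> \<bar>h p\<bar> \<le> B"
    by (auto simp: bounded_iff)
  have "(\<bar>A\<bar> * M + \<bar>B\<bar> * L)-lipschitz_on S (\<lambda>p. g p * h p)"
  proof (rule lipschitz_onI)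
    show "0 \<le> \<bar>A\<bar> * M + \<bar>B\<bar> * L"
      using lipschitz_on_nonneg[OF L] lipschitz_on_nonneg[OF M] by simp
    fix p q assume pq: "p \<in> S" "q \<in> S"
    have "dist (g p * h p) (g q * h q) = \<bar>g p * (h p - h q) + h q * (g p - g q)\<bar>"
      by (simp add: dist_real_def algebra_simps)
    also have "\<dots> \<le> \<bar>g p\<bar> * \<bar>h p - h q\<bar> + \<bar>h q\<bar> * \<bar>g p - g q\<bar>"
      by (metis abs_mult abs_triangle_ineq)
    also have "\<dots> \<le> \<bar>A\<bar> * (M * dist p q) + \<bar>B\<bar> * (L * dist p q)"
      using A[OF pq(1)] B[OF pq(2)] lipschitz_onD[OF L pq] lipschitz_onD[OF M pq]
      by (intro add_mono mult_mono) (auto simp: dist_real_def)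
    finally show "dist (g p * h p) (g q * h q) \<le> (\<bar>A\<bar> * M + \<bar>B\<bar> * L) * dist p q"
      by (simp add: algebra_simps)
  qed
  then show ?thesis by blast
qed

lemma has_vector_derivative_tuple4:
  fixes a b c d :: "real \<Rightarrow> real"
  shows "((\<lambda>t. (a t, b t, c t, d t)) has_vector_derivative (a', b', c', d')) (at t within S) \<longleftrightarrow>
     (a has_real_derivative a') (at t within S) \<and> (b has_real_derivative b') (at t within S) \<and>
     (c has_real_derivative c') (at t within S) \<and> (d has_real_derivative d') (at t within S)"
    (is "?L \<longleftrightarrow> ?R")
proof
  assume L: ?L
  note 1 = bounded_linear.has_vector_derivative[OF bounded_linear_fst L]
  note s1 = bounded_linear.has_vector_derivative[OF bounded_linear_snd L]
  note 2 = bounded_linear.has_vector_derivative[OF bounded_linear_fst s1]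
  note s2 = bounded_linear.has_vector_derivative[OF bounded_linear_snd s1]
  note 3 = bounded_linear.has_vector_derivative[OF bounded_linear_fst s2]
  note 4 = bounded_linear.has_vector_derivative[OF bounded_linear_snd s2]
  show ?R using 1 2 3 4 by (simp add: has_real_derivative_iff_has_vector_derivative)
next
  assume ?R
  then show ?L
    by (auto simp: has_real_derivative_iff_has_vector_derivative
        intro!: has_vector_derivative_Pair)
qed

subsection \<open>The system in the original scalar field\<close>

text \<open>The third component is that of \<open>theta2\<close>: neither \<open>\<psi>\<close> nor
  \<open>u\<close> occurs, because under the constraint \<open>theta1\<close> and
  \<open>theta2\<close> agree wherever \<open>\<psi>\<close> differs from 1.\<close>

definition phi_field :: "(real \<Rightarrow> real) \<Rightarrow> state \<Rightarrow> state" where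
  "phi_field V = (\<lambda>(\<phi>, x, w, z).
     (w,
      - (x / sqrt 6) * (3 * w\<^sup>2 + z\<^sup>2),
      sqrt (3/2) * w * (1 - w\<^sup>2 - z\<^sup>2 / 3) - 1/2 * deriv V \<phi> * x\<^sup>2,
      z / sqrt 6 * (1 - 3 * w\<^sup>2 - z\<^sup>2)))"

definition phi_admissible :: "(real \<Rightarrow> real) \<Rightarrow> state set" where
  "phi_admissible V = {(\<phi>, x, w, z). 0 < x \<and> V \<phi> * x\<^sup>2 + w\<^sup>2 + z\<^sup>2 = 1}"

text \<open>The constraint and \<open>x > 0\<close> are imposed at time 0 only;
  \<open>phi_solution_bounds\<close> propagates them. The domain \<open>S\<close> is a parameter so
  that one notion covers \<open>{0..b}\<close> and \<open>{0..}\<close>.\<close>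

definition phi_solution :: "(real \<Rightarrow> real) \<Rightarrow> real set \<Rightarrow> (real \<Rightarrow> state) \<Rightarrow> bool" where
  "phi_solution V S g \<longleftrightarrow>
     (\<forall>t\<in>S. (g has_vector_derivative phi_field V (g t)) (at t within S)) \<and>
     (0 \<in> S \<longrightarrow> g 0 \<in> phi_admissible V)"

text \<open>A box rather than a ball, so that \<open>clamp\<close> maps onto it without increasing
  distances.\<close>

definition cube :: "real \<Rightarrow> state set" where
  "cube R = cbox (-R, -R, -R, -R) (R, R, R, R)"

lemma mem_cube: "(\<phi>, x, w, z) \<in> cube R \<longleftrightarrow> \<bar>\<phi>\<bar> \<le> R \<and> \<bar>x\<bar> \<le> R \<and> \<bar>w\<bar> \<le> R \<and> \<bar>z\<bar> \<le> R"
  by (auto simp: cube_def cbox_Pair_eq)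

lemma tuple4_fun:
  obtains a b c d where "g = (\<lambda>t. (a t, b t, c t, d t))"
proof
  show "g = (\<lambda>t. (fst (g t), fst (snd (g t)), fst (snd (snd (g t))), snd (snd (snd (g t)))))"
    by simp
qed

lemma phi_solution_subset:
  assumes "phi_solution V S g" "T \<subseteq> S"
  shows "phi_solution V T g"
  using assms unfolding phi_solution_def
  by (meson has_vector_derivative_within_subset subset_iff)

lemma C2_realD:
  assumes "C2_real V"
  shows "(V has_real_derivative deriv V t) (at t)"
    and "(deriv V has_real_derivative deriv (deriv V) t) (at t)"
    and "continuous_on UNIV (deriv (deriv V))"
    and "continuous_on UNIV (deriv V)"
    and "continuous_on UNIV V"
proof -
  show 1: "(V has_real_derivative deriv V t) (at t)" for t
    using assms by (auto simp: C2_real_def DERIV_deriv_iff_real_differentiable)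
  show 2: "(deriv V has_real_derivative deriv (deriv V) t) (at t)" for t
    using assms by (auto simp: C2_real_def DERIV_deriv_iff_real_differentiable)
  show "continuous_on UNIV (deriv (deriv V))"
    using assms by (simp add: C2_real_def)
  show "continuous_on UNIV (deriv V)" "continuous_on UNIV V"
    using 1 2 by (meson DERIV_isCont continuous_at_imp_continuous_on)+
qed

text \<open>On a compact set the Lipschitz functions are closed under sums and products, so the only
  analytic input is \<open>deriv V\<close>, which is Lipschitz on intervals because the second
  derivative is continuous.\<close>

lemma phi_field_lipschitz:
  assumes V: "C2_real V"
  shows "\<exists>L. L-lipschitz_on (cube R) (phi_field V)"
proof -
  let ?lip = "\<lambda>g :: state \<Rightarrow> real. \<exists>L. L-lipschitz_on (cube R) g"
  have comp: "compact (cube R)" by (simp add: cube_def)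
  have mult: "?lip (\<lambda>p. g p * h p)" if "?lip g" "?lip h" for g h
    by (rule lipschitz_mult_compact[OF comp that])
  have add: "?lip (\<lambda>p. g p + h p)" if "?lip g" "?lip h" for g h
    using that lipschitz_on_add by blast
  have diff: "?lip (\<lambda>p. g p - h p)" if "?lip g" "?lip h" for g h
    using that lipschitz_on_diff by blast
  have cst: "?lip (\<lambda>p. c)" for c using lipschitz_on_constant by blast
  have lin: "?lip g" if "bounded_linear g" for g
    using bounded_linear.lipschitz_boundE[OF that] by metis
  have pr: "?lip (\<lambda>p. fst p)" "?lip (\<lambda>p. fst (snd p))" "?lip (\<lambda>p. fst (snd (snd p)))"
    "?lip (\<lambda>p. snd (snd (snd p)))"
    by (intro lin bounded_linear_intros)+
  have dV: "?lip (\<lambda>p. deriv V (fst p))"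
  proof -
    obtain B where B: "\<And>t. t \<in> {-R..R} \<Longrightarrow> \<bar>deriv (deriv V) t\<bar> \<le> B"
      using compact_abs_bound[OF compact_Icc[of "- R" R] continuous_on_subset[OF C2_realD(3)[OF V] subset_UNIV]]
      by blast
    have lB: "\<bar>B\<bar>-lipschitz_on {-R..R} (deriv V)"
    proof (rule bounded_derivative_imp_lipschitz)
      fix t assume t: "t \<in> {-R..R}"
      show "(deriv V has_derivative (*) (deriv (deriv V) t)) (at t within {-R..R})"
        using C2_realD(2)[OF V, of t]
        by (simp add: has_field_derivative_def has_derivative_at_withinI)
      show "onorm ((*) (deriv (deriv V) t)) \<le> \<bar>B\<bar>"
        using B[OF t] by (intro onorm_le) (auto simp: abs_mult intro!: mult_right_mono)
    qed auto
    obtain L where L: "L-lipschitz_on (cube R) (fst :: state \<Rightarrow> real)"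
      using pr(1) by auto
    have "fst ` cube R \<subseteq> {-R..R}" by (auto simp: mem_cube abs_le_iff)
    from lipschitz_on_compose2[OF L lipschitz_on_subset[OF lB this]]
    show ?thesis by blast
  qed
  \<comment> \<open>Powers and quotients are rewritten as products of projections and constants, so
    that the closure rules above apply mechanically.\<close>
  have *: "phi_field V = (\<lambda>p. (fst (snd (snd p)),
      (- 1 / sqrt 6) * fst (snd p) * (3 * (fst (snd (snd p)) * fst (snd (snd p))) +
         snd (snd (snd p)) * snd (snd (snd p))),
      sqrt (3/2) * fst (snd (snd p)) * (1 - fst (snd (snd p)) * fst (snd (snd p)) -
          1/3 * (snd (snd (snd p)) * snd (snd (snd p)))) -
        1/2 * deriv V (fst p) * (fst (snd p) * fst (snd p)),
      1 / sqrt 6 * snd (snd (snd p)) *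
        (1 - 3 * (fst (snd (snd p)) * fst (snd (snd p))) - snd (snd (snd p)) * snd (snd (snd p)))))"
    by (auto simp: phi_field_def fun_eq_iff power2_eq_square)
  have pair: "\<exists>L. L-lipschitz_on (cube R) (\<lambda>p. (g p, h p))"
    if "?lip g" "\<exists>L. L-lipschitz_on (cube R) h" for g and h :: "state \<Rightarrow> 'b::metric_space"
    using that lipschitz_on_Pair by blast
  show ?thesis
    unfolding * by (intro pair mult add diff cst pr dV)
qed

lemma phi_solution_tuple:
  assumes "phi_solution V S (\<lambda>t. (\<phi> t, x t, w t, z t))" "t \<in> S"
  shows "(\<phi> has_real_derivative w t) (at t within S)"
    and "(x has_real_derivative (- (3 * (w t)\<^sup>2 + (z t)\<^sup>2) / sqrt 6) * x t) (at t within S)"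
    and "(w has_real_derivative sqrt (3/2) * w t * (1 - (w t)\<^sup>2 - (z t)\<^sup>2 / 3)
           - 1/2 * deriv V (\<phi> t) * (x t)\<^sup>2) (at t within S)"
    and "(z has_real_derivative (1 - 3 * (w t)\<^sup>2 - (z t)\<^sup>2) / sqrt 6 * z t) (at t within S)"
proof -
  have "((\<lambda>t. (\<phi> t, x t, w t, z t)) has_vector_derivative
      (w t, - (x t / sqrt 6) * (3 * (w t)\<^sup>2 + (z t)\<^sup>2),
       sqrt (3/2) * w t * (1 - (w t)\<^sup>2 - (z t)\<^sup>2 / 3) - 1/2 * deriv V (\<phi> t) * (x t)\<^sup>2,
       z t / sqrt 6 * (1 - 3 * (w t)\<^sup>2 - (z t)\<^sup>2))) (at t within S)"
    using assms unfolding phi_solution_def phi_field_def prod.case by blast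
  note D = this[unfolded has_vector_derivative_tuple4]
  show "(\<phi> has_real_derivative w t) (at t within S)"
    and "(w has_real_derivative sqrt (3/2) * w t * (1 - (w t)\<^sup>2 - (z t)\<^sup>2 / 3)
           - 1/2 * deriv V (\<phi> t) * (x t)\<^sup>2) (at t within S)"
    using D by blast+
  show "(x has_real_derivative (- (3 * (w t)\<^sup>2 + (z t)\<^sup>2) / sqrt 6) * x t) (at t within S)"
    by (rule DERIV_cong[OF D[THEN conjunct2, THEN conjunct1]]) (simp add: divide_inverse algebra_simps)
  show "(z has_real_derivative (1 - 3 * (w t)\<^sup>2 - (z t)\<^sup>2) / sqrt 6 * z t) (at t within S)"
    by (rule DERIV_cong[OF D[THEN conjunct2, THEN conjunct2, THEN conjunct2]]) simp
qed

section \<open>A priori bounds, dependence on initial data and global existence\<close>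

lemma sqrt_three_halves: "sqrt (3/2) = 3 / sqrt 6"
  by (rule real_sqrt_unique) (auto simp: power_divide)

lemma abs_le_of_square_le: "\<bar>a\<bar> \<le> B" if "a\<^sup>2 \<le> B" "1 \<le> B" for a B :: real
proof -
  have "B * 1 \<le> B * B" using that by (intro mult_left_mono) auto
  then have "a\<^sup>2 \<le> B * B" using that by linarith
  then have "\<bar>a\<bar>\<^sup>2 \<le> B\<^sup>2" by (simp add: power2_eq_square[of B])
  then show ?thesis using that by (intro power2_le_imp_le[of "\<bar>a\<bar>" B]) auto
qed

text \<open>The constraint defect \<open>E\<close> solves a homogeneous linear equation, hence stays
  0. Then \<open>- C \<le> V\<close> and \<open>x t \<le> x 0\<close> bound \<open>w\<close> and
  \<open>z\<close>, and \<open>w\<close> is the speed of \<open>\<phi>\<close>. The bound is stated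
  with \<open>X\<close> instead of \<open>x 0\<close> to be uniform over a family of initial
  data.\<close>

lemma phi_solution_bounds:
  assumes V: "C2_real V" and C: "0 \<le> C" "\<And>t. - C \<le> V t"
    and sol: "phi_solution V {0..b} (\<lambda>t. (\<phi> t, x t, w t, z t))"
    and X: "x 0 \<le> X" and t: "t \<in> {0..b}"
  shows "V (\<phi> t) * (x t)\<^sup>2 + (w t)\<^sup>2 + (z t)\<^sup>2 = 1" "0 < x t" "x t \<le> x 0"
    "(w t)\<^sup>2 + (z t)\<^sup>2 \<le> 1 + C * X\<^sup>2" "\<bar>\<phi> t\<bar> \<le> \<bar>\<phi> 0\<bar> + (1 + C * X\<^sup>2) * b"
proof -
  have init: "V (\<phi> 0) * (x 0)\<^sup>2 + (w 0)\<^sup>2 + (z 0)\<^sup>2 = 1" "0 < x 0"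
    using sol t by (auto simp: phi_solution_def phi_admissible_def)
  note D = phi_solution_tuple[OF sol]
  have cont: "continuous_on {0..b} w" "continuous_on {0..b} z"
    using D(3,4) by (meson DERIV_continuous continuous_on_eq_continuous_within)+
  define E where "E s = V (\<phi> s) * (x s)\<^sup>2 + (w s)\<^sup>2 + (z s)\<^sup>2 - 1" for s
  have E0: "E s = 0" if s: "s \<in> {0..b}" for s
  proof (rule linear_ode_continuous_bounds(1)[where e = E, OF _ _ s])
    fix r assume r: "r \<in> {0..b}"
    note [derivative_intros] = D[OF r] DERIV_chain2[OF C2_realD(1)[OF V] D(1)[OF r]]
    \<comment> \<open>The two terms with \<open>deriv V\<close> cancel, and the rest factors through
      \<open>3 * w\<^sup>2 + z\<^sup>2\<close>.\<close>
    show "(E has_real_derivative (- 2 * (3 * (w r)\<^sup>2 + (z r)\<^sup>2) / sqrt 6) * E r) (at r within {0..b})"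
      unfolding E_def
      by (rule derivative_eq_intros refl)+
        (simp add: sqrt_three_halves algebra_simps power2_eq_square add_divide_distrib diff_divide_distrib)
  next
    show "continuous_on {0..b} (\<lambda>r. - 2 * (3 * (w r)\<^sup>2 + (z r)\<^sup>2) / sqrt 6)"
      by (intro continuous_intros cont) auto
    show "E 0 = 0" using init by (simp add: E_def)
  qed
  then have con: "V (\<phi> s) * (x s)\<^sup>2 + (w s)\<^sup>2 + (z s)\<^sup>2 = 1" if "s \<in> {0..b}" for s
    using that by (simp add: E_def)
  have pos: "0 < x s" if s: "s \<in> {0..b}" for s
  proof (rule linear_ode_continuous_bounds(2)[OF D(2) _ s])
    show "continuous_on {0..b} (\<lambda>r. - (3 * (w r)\<^sup>2 + (z r)\<^sup>2) / sqrt 6)"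
      by (intro continuous_intros cont) auto
  qed (use init in auto)
  have dec: "x s \<le> x 0" if s: "s \<in> {0..b}" for s
  proof -
    have "x s \<le> x 0 * exp (0 * (s - 0))"
    proof (rule gronwall_real[OF D(2) _ s])
      fix r assume "r \<in> {0..b}"
      then show "(- (3 * (w r)\<^sup>2 + (z r)\<^sup>2) / sqrt 6) * x r \<le> 0 * x r"
        using pos[of r] zero_le_power2[of "w r"] zero_le_power2[of "z r"]
        by (intro mult_right_mono divide_nonpos_nonneg) (linarith | simp)+
    qed
    then show ?thesis by simp
  qed
  have wz: "(w s)\<^sup>2 + (z s)\<^sup>2 \<le> 1 + C * X\<^sup>2" if s: "s \<in> {0..b}" for s
  proof -
    have "(x s)\<^sup>2 \<le> X\<^sup>2" using pos[OF s] dec[OF s] X by (intro power_mono) auto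
    then have "C * (x s)\<^sup>2 \<le> C * X\<^sup>2" using C by (intro mult_left_mono) auto
    moreover have "- C * (x s)\<^sup>2 \<le> V (\<phi> s) * (x s)\<^sup>2" using C by (intro mult_right_mono) auto
    ultimately show ?thesis using con[OF s] by simp
  qed
  have B: "1 \<le> 1 + C * X\<^sup>2" using C by simp
  have w: "\<bar>w s\<bar> \<le> 1 + C * X\<^sup>2" if "s \<in> {0..b}" for s
    using wz[OF that] by (intro abs_le_of_square_le B) (smt (verit) zero_le_power2)
  have "norm (\<phi> t - \<phi> 0) \<le> (1 + C * X\<^sup>2) * norm (t - 0)"
    by (rule field_differentiable_bound[OF _ D(1)]) (use w t in auto)
  then have "\<bar>\<phi> t - \<phi> 0\<bar> \<le> (1 + C * X\<^sup>2) * t" using t by simp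
  moreover have "(1 + C * X\<^sup>2) * t \<le> (1 + C * X\<^sup>2) * b" using t B by (intro mult_left_mono) auto
  ultimately show "\<bar>\<phi> t\<bar> \<le> \<bar>\<phi> 0\<bar> + (1 + C * X\<^sup>2) * b" by simp
  show "V (\<phi> t) * (x t)\<^sup>2 + (w t)\<^sup>2 + (z t)\<^sup>2 = 1" "0 < x t" "x t \<le> x 0"
    "(w t)\<^sup>2 + (z t)\<^sup>2 \<le> 1 + C * X\<^sup>2"
    using con pos dec wz t by auto
qed

text \<open>With \<open>\<bar>\<phi> 0\<bar> \<le> P\<close> and \<open>x 0 \<le> X\<close>, the
  factor \<open>1 + C * X\<^sup>2\<close> bounds \<open>\<bar>w\<bar>\<close> and
  \<open>\<bar>z\<bar>\<close>; its multiple by \<open>b\<close> is the distance that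
  \<open>\<phi>\<close> can travel, and the last \<open>X\<close> accounts for
  \<open>x\<close>.\<close>

definition cube_radius :: "real \<Rightarrow> real \<Rightarrow> real \<Rightarrow> real \<Rightarrow> real" where
  "cube_radius C P X b = P + (1 + C * X\<^sup>2) * (1 + b) + X"

lemma cube_mono: "R \<le> R' \<Longrightarrow> cube R \<subseteq> cube R'"
  by (auto simp: mem_cube)

lemma cube_radius_mono: "0 \<le> C \<Longrightarrow> b \<le> b' \<Longrightarrow> cube_radius C P X b \<le> cube_radius C P X b'"
  unfolding cube_radius_def by (simp add: mult_left_mono)

lemma phi_solution_in_cube:
  assumes V: "C2_real V" and C: "0 \<le> C" "\<And>t. - C \<le> V t"
    and sol: "phi_solution V {0..b} g" and t: "t \<in> {0..b}"
    and P: "\<bar>fst (g 0)\<bar> \<le> P" and X: "fst (snd (g 0)) \<le> X"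
  shows "g t \<in> cube (cube_radius C P X b)"
proof -
  obtain \<phi> x w z where g: "g = (\<lambda>t. (\<phi> t, x t, w t, z t))" by (rule tuple4_fun)
  note bd = phi_solution_bounds[OF V C sol[unfolded g] _ t, of X]
  have B: "1 \<le> 1 + C * X\<^sup>2" using C by simp
  have "x 0 \<le> X" using X by (simp add: g)
  note bd = bd[OF this]
  have wz: "\<bar>w t\<bar> \<le> 1 + C * X\<^sup>2" "\<bar>z t\<bar> \<le> 1 + C * X\<^sup>2"
    using bd(4) by (auto intro!: abs_le_of_square_le B) (smt (verit) zero_le_power2)+
  have "0 \<le> (1 + C * X\<^sup>2) * b" using B t by (intro mult_nonneg_nonneg) auto
  then show ?thesis
    using bd(2,3,5) wz P \<open>x 0 \<le> X\<close> B by (auto simp: g mem_cube cube_radius_def algebra_simps)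
qed

text \<open>The order of quantifiers matters: one \<open>L\<close> serves all solutions whose
  initial data obey the bounds \<open>P\<close> and \<open>X\<close>, since all of them stay in the
  same cube. Openness compares a solution with all its neighbours at once.\<close>

lemma phi_solution_dependence:
  assumes V: "C2_real V" and C: "0 \<le> C" "\<And>t. - C \<le> V t"
  shows "\<exists>L. \<forall>g h. phi_solution V {0..b} g \<and> phi_solution V {0..b} h \<and>
       \<bar>fst (g 0)\<bar> \<le> P \<and> fst (snd (g 0)) \<le> X \<and> \<bar>fst (h 0)\<bar> \<le> P \<and> fst (snd (h 0)) \<le> X \<longrightarrow>
       (\<forall>t\<in>{0..b}. dist (g t) (h t) \<le> exp (L * t) * dist (g 0) (h 0))"
proof -
  obtain L where L: "L-lipschitz_on (cube (cube_radius C P X b)) (phi_field V)"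
    using phi_field_lipschitz[OF V] by blast
  have "dist (g t) (h t) \<le> exp (L * t) * dist (g 0) (h 0)"
    if A: "phi_solution V {0..b} g" "phi_solution V {0..b} h" "t \<in> {0..b}"
       "\<bar>fst (g 0)\<bar> \<le> P" "fst (snd (g 0)) \<le> X" "\<bar>fst (h 0)\<bar> \<le> P" "fst (snd (h 0)) \<le> X" for g h t
  proof -
    have "dist (g t) (h t) \<le> exp (L * (t - 0)) * dist (g 0) (h 0)"
    proof (rule ode_solutions_dist[OF L _ _ _ _ A(3)])
      show "g s \<in> cube (cube_radius C P X b)" "h s \<in> cube (cube_radius C P X b)"
        if "s \<in> {0..b}" for s
        using phi_solution_in_cube[OF V C] A that by blast+
    qed (use A in \<open>auto simp: phi_solution_def\<close>)
    then show ?thesis by simp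
  qed
  then show ?thesis by blast
qed

lemma phi_solution_unique:
  assumes V: "C2_real V" and C: "0 \<le> C" "\<And>t. - C \<le> V t"
    and "phi_solution V {0..b} g" "phi_solution V {0..b} h" "g 0 = h 0" "t \<in> {0..b}"
  shows "g t = h t"
proof -
  obtain L where "dist (g t) (h t) \<le> exp (L * t) * dist (g 0) (h 0)"
    using phi_solution_dependence[OF V C, of b "\<bar>fst (g 0)\<bar>" "fst (snd (g 0))"] assms
    by (metis order_refl)
  then show ?thesis using assms by simp
qed

text \<open>Composing the field with the clamp onto a cube makes it globally Lipschitz. The a priori
  bound confines true solutions to radius \<open>R\<close>, strictly inside the clamping radius
  \<open>R + 1\<close>, so the clamp is never felt.\<close>

lemma phi_solution_exists_bounded:
  assumes V: "C2_real V" and C: "0 \<le> C" "\<And>t. - C \<le> V t"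
    and q: "q \<in> phi_admissible V" and N: "0 \<le> N"
  shows "\<exists>g. g 0 = q \<and> phi_solution V {0..N} g"
proof -
  define R where "R = cube_radius C \<bar>fst q\<bar> (fst (snd q)) N"
  obtain L where L: "L-lipschitz_on (cube (R + 1)) (phi_field V)"
    using phi_field_lipschitz[OF V] by blast
  define cl where "cl = clamp (- (R+1), - (R+1), - (R+1), - (R+1)) (R+1, R+1, R+1, R+1)"
  have R: "0 \<le> R"
    using q C N by (auto simp: R_def cube_radius_def phi_admissible_def intro!: add_nonneg_nonneg)
  have cl_cube: "cl p \<in> cube (R + 1)" for p
    unfolding cl_def cube_def
    using R by (intro clamp_in_interval) (auto simp: Basis_prod_def)
  have cl_id: "cl p = p" if "p \<in> cube (R + 1)" for p
    unfolding cl_def using that by (intro clamp_cancel_cbox) (simp add: cube_def)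
  have "L-lipschitz_on UNIV (\<lambda>p. phi_field V (cl p))"
  proof (rule lipschitz_onI[OF _ lipschitz_on_nonneg[OF L]])
    fix p p'
    have "dist (phi_field V (cl p)) (phi_field V (cl p')) \<le> L * dist (cl p) (cl p')"
      by (rule lipschitz_onD[OF L cl_cube cl_cube])
    also have "\<dots> \<le> L * dist p p'"
      unfolding cl_def by (intro mult_left_mono dist_clamps_le_dist_args lipschitz_on_nonneg[OF L])
    finally show "dist (phi_field V (cl p)) (phi_field V (cl p')) \<le> L * dist p p'" .
  qed
  from picard_lipschitz[OF this N, of q]
  obtain y where y0: "y 0 = q"
    and y: "\<And>t. t \<in> {0..N} \<Longrightarrow> (y has_vector_derivative phi_field V (cl (y t))) (at t within {0..N})"
    by blast
  \<comment> \<open>An open set between \<open>cube R\<close> and \<open>cube (R + 1)\<close>: open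
    as \<open>first_exit\<close> requires, large enough to contain the a priori region, small enough
    that the clamp is the identity on it.\<close>
  define S :: "state set" where
    "S = {p. \<bar>fst p\<bar> < R + 1} \<inter> {p. \<bar>fst (snd p)\<bar> < R + 1} \<inter> {p. \<bar>fst (snd (snd p))\<bar> < R + 1}
       \<inter> {p. \<bar>snd (snd (snd p))\<bar> < R + 1}"
  have "open S" unfolding S_def by (intro open_Int open_Collect_less continuous_intros)
  have SK: "S \<subseteq> cube (R + 1)" by (auto simp: S_def mem_cube)
  have KS: "cube R \<subseteq> S" by (auto simp: S_def mem_cube)
  have cont: "continuous_on {0..N} y" using y by (rule has_vector_derivative_imp_continuous_on)
  have sol: "phi_solution V {0..t} y" if t: "t \<in> {0..N}" and "\<And>s. s \<in> {0..t} \<Longrightarrow> y s \<in> cube (R + 1)" for t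
    unfolding phi_solution_def
  proof (intro conjI ballI impI)
    fix s assume s: "s \<in> {0..t}"
    then have "(y has_vector_derivative phi_field V (cl (y s))) (at s within {0..t})"
      using t by (intro has_vector_derivative_within_subset[OF y]) auto
    then show "(y has_vector_derivative phi_field V (y s)) (at s within {0..t})"
      using cl_id that(2)[OF s] by simp
  qed (use y0 q in simp)
  have "y t \<in> S" if t: "t \<in> {0..N}" for t
  proof (rule first_exit[OF cont \<open>open S\<close> _ t])
    fix t assume t: "t \<in> {0..N}" and less: "\<And>s. 0 \<le> s \<Longrightarrow> s < t \<Longrightarrow> y s \<in> S"
    have ycube: "y s \<in> cube (R + 1)" if s: "s \<in> {0..t}" for s
    proof (cases "t = 0")
      case True
      have "q \<in> cube R"
      proof -
        \<comment> \<open>On a one-point interval every derivative condition is trivial, so a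
          constant function lets the a priori bound speak about \<open>q\<close> itself.\<close>
        have "phi_solution V {0..0} (\<lambda>_. q)"
          using q by (simp add: phi_solution_def has_vector_derivative_def
              has_derivative_within_singleton_iff bounded_linear_scaleR_left)
        from phi_solution_in_cube[OF V C this, of 0] have "q \<in> cube (cube_radius C \<bar>fst q\<bar> (fst (snd q)) 0)"
          by simp
        moreover have "cube (cube_radius C \<bar>fst q\<bar> (fst (snd q)) 0) \<subseteq> cube R"
          unfolding R_def by (intro cube_mono cube_radius_mono C N)
        ultimately show ?thesis by blast
      qed
      then show ?thesis using True s y0 KS SK by auto
    next
      case False
      then have "t > 0" using t by simp
      \<comment> \<open>Membership in the closed cube passes from earlier times to \<open>t\<close>;
        only then is \<open>y\<close> known to solve the unclamped equation up to and including
        \<open>t\<close>.\<close>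
      have "y ` closure {0..<t} \<subseteq> cube (R + 1)"
      proof (rule image_closure_subset)
        show "continuous_on (closure {0..<t}) y"
          using \<open>t > 0\<close> t by (intro continuous_on_subset[OF cont]) auto
        show "closed (cube (R + 1))" unfolding cube_def by (rule closed_cbox)
        show "y ` {0..<t} \<subseteq> cube (R + 1)" using less SK by auto
      qed
      then show ?thesis using \<open>t > 0\<close> s by auto
    qed
    have "y t \<in> cube (cube_radius C \<bar>fst q\<bar> (fst (snd q)) t)"
      by (rule phi_solution_in_cube[OF V C sol[OF t ycube]]) (use t y0 in auto)
    moreover have "cube (cube_radius C \<bar>fst q\<bar> (fst (snd q)) t) \<subseteq> cube R"
      unfolding R_def using t by (intro cube_mono cube_radius_mono C) simp
    ultimately have "y t \<in> cube R" by blast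
    then show "y t \<in> S" using KS by blast
  qed
  then have "phi_solution V {0..N} y" using sol[of N] SK N by auto
  then show ?thesis using y0 by blast
qed

text \<open>Solutions on \<open>{0..n}\<close> are chosen independently for each \<open>n\<close>;
  uniqueness makes them agree on common intervals, so they glue.\<close>

lemma phi_solution_exists:
  assumes V: "C2_real V" and C: "0 \<le> C" "\<And>t. - C \<le> V t"
    and q: "q \<in> phi_admissible V"
  shows "\<exists>g. g 0 = q \<and> phi_solution V {0..} g"
proof -
  define Y where "Y n = (SOME g. g 0 = q \<and> phi_solution V {0..real n} g)" for n :: nat
  have Y: "Y n 0 = q" "phi_solution V {0..real n} (Y n)" for n
    using someI_ex[OF phi_solution_exists_bounded[OF V C q, of "real n"]]
    by (simp_all add: Y_def)
  define g where "g t = Y (nat \<lceil>t\<rceil>) t" for t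
  have gY: "g t = Y n t" if "0 \<le> t" "t \<le> real n" for t n
    unfolding g_def
  proof (rule phi_solution_unique[OF V C, where b = t and t = t and g = "Y (nat \<lceil>t\<rceil>)" and h = "Y n"])
    have "t \<le> real (nat \<lceil>t\<rceil>)" by linarith
    then show "phi_solution V {0..t} (Y (nat \<lceil>t\<rceil>))"
      by (intro phi_solution_subset[OF Y(2)]) auto
    show "phi_solution V {0..t} (Y n)"
      using that by (intro phi_solution_subset[OF Y(2)]) auto
  qed (use that Y in auto)
  have "(g has_vector_derivative phi_field V (g t)) (at t within {0..})" if t: "t \<in> {0..}" for t
  proof -
    obtain n :: nat where n: "t < real n" using reals_Archimedean2 by blast
    have "(Y n has_vector_derivative phi_field V (Y n t)) (at t within {0..real n})"
      using Y(2)[of n] t n by (simp add: phi_solution_def)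
    then have "(g has_vector_derivative phi_field V (g t)) (at t within {0..real n})"
      unfolding gY[OF that[simplified] less_imp_le[OF n]]
      by (rule has_vector_derivative_transform[rotated 2]) (use t n gY in auto)
    \<comment> \<open>Strictness of \<open>t < n\<close> is essential here: at the right end of
      \<open>{0..n}\<close> the derivative would be one-sided.\<close>
    moreover have "at t within {0..real n} = at t within {0..}"
      by (rule at_within_nhd[of _ "{..<real n}"]) (use n in auto)
    ultimately show ?thesis by simp
  qed
  moreover have "g 0 = q" using gY[of 0 0] Y by simp
  ultimately show ?thesis using q by (auto simp: phi_solution_def)
qed

lemma solution_domain_subset: "0 \<le> t \<Longrightarrow> ereal t < T \<Longrightarrow> {0..t} \<subseteq> {\<tau>. 0 \<le> \<tau> \<and> ereal \<tau> < T}"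
  by auto (meson ereal_less_eq(3) order_le_less_trans)

subsection \<open>Change of coordinates\<close>

locale compactified_potential =
  fixes f V \<psi> :: "real \<Rightarrow> real" and \<delta> :: real
  assumes compact_f: "compactification f" and V: "assumption_V f V" and cut: "cutoff f V \<delta> \<psi>"
begin

lemma f_mono: "strict_mono f"
  using compact_f by (simp add: compactification_def)

lemma f_inv: "\<bar>s\<bar> < 1 \<Longrightarrow> f (inv f s) = s"
  using compact_f by (intro f_inv_into_f) (auto simp: compactification_def bij_betw_def)

lemma inv_f [simp]: "inv f (f \<phi>) = \<phi>"
  by (rule inv_f_f[OF strict_mono_imp_inj_on[OF f_mono]])

lemma f_abs: "\<bar>f \<phi>\<bar> < 1"
proof -
  have "f \<phi> \<in> {-1<..<1}"
    using compact_f unfolding compactification_def bij_betw_def by blast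
  then show ?thesis by auto
qed

lemma f_deriv: "(f has_real_derivative deriv f \<phi>) (at \<phi>)" "deriv f \<phi> > 0"
  using compact_f C2_realD(1)[of f] by (simp_all add: compactification_def)

lemma isCont_inv_f: "\<bar>s\<bar> < 1 \<Longrightarrow> isCont (inv f) s"
  using isCont_inverse_function2[of "inv f s - 1" "inv f s" "inv f s + 1" "inv f" f]
    DERIV_isCont[OF f_deriv(1)] f_inv[of s] by simp

lemma inv_f_deriv: "\<bar>s\<bar> < 1 \<Longrightarrow> (inv f has_real_derivative inverse (deriv f (inv f s))) (at s)"
  using f_deriv[of "inv f s"]
  by (intro DERIV_inverse_function[where a = "-1" and b = 1 and f = f])
    (auto simp: isCont_inv_f intro!: f_inv)

lemma C2_V: "C2_real V"
  using V by (simp add: assumption_V_def)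

lemma V_bounded_below: obtains C where "0 \<le> C" "\<And>t. - C \<le> V t"
proof -
  obtain a b where ab: "\<And>t. t \<le> a \<Longrightarrow> 0 < V t" "\<And>t. t \<ge> b \<Longrightarrow> 0 < V t"
    using V by (auto simp: assumption_V_def eventually_at_bot_linorder eventually_at_top_linorder)
  obtain K where K: "\<And>t. t \<in> {a..b} \<Longrightarrow> \<bar>V t\<bar> \<le> K"
    using compact_abs_bound[OF compact_Icc[of a b] continuous_on_subset[OF C2_realD(5)[OF C2_V] subset_UNIV]]
    by blast
  show ?thesis
  proof
    show "- \<bar>K\<bar> \<le> V t" for t
      using ab(1)[of t] ab(2)[of t] K[of t] by (cases "t \<le> a"; cases "b \<le> t") auto
  qed simp
qed

definition from_phi :: "state \<Rightarrow> state" where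
  "from_phi = (\<lambda>(\<phi>, x, w, z). (f \<phi>, x, w, z))"

definition to_phi :: "state \<Rightarrow> state" where
  "to_phi = (\<lambda>(s, x, w, z). (inv f s, x, w, z))"

lemma from_phi_to_phi: "\<bar>fst p\<bar> < 1 \<Longrightarrow> from_phi (to_phi p) = p"
  by (auto simp: to_phi_def from_phi_def f_inv split: prod.splits)

lemma from_phi_admissible: "p \<in> phi_admissible V \<Longrightarrow> from_phi p \<in> admissible f V"
  using f_abs by (auto simp: from_phi_def phi_admissible_def admissible_def abs_less_iff)

lemma to_phi_admissible: "p \<in> admissible f V \<Longrightarrow> to_phi p \<in> phi_admissible V"
  by (auto simp: to_phi_def phi_admissible_def admissible_def)

text \<open>Where \<open>\<psi> s\<close> differs from 1, the cutoff guarantees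
  \<open>V > 0\<close>, so \<open>sqrt (3/2) * u * V\<close> is half of \<open>deriv V\<close>, and
  \<open>theta1\<close> becomes \<open>theta2\<close> plus a multiple of the constraint defect.
  Keeping the defect explicit serves two purposes: it is 0 for constrained solutions, and it gives a
  linear equation for itself in \<open>admissible_invariant\<close>.\<close>

lemma vec_field_interior:
  assumes s: "\<bar>s\<bar> < 1"
  shows "vec_field f V \<psi> (s, x, w, z) =
    (deriv f (inv f s) * w,
     - (x / sqrt 6) * (3 * w\<^sup>2 + z\<^sup>2),
     sqrt (3/2) * w * (1 - w\<^sup>2 - z\<^sup>2 / 3) - 1/2 * deriv V (inv f s) * x\<^sup>2
       + sqrt (3/2) * ((1 - \<psi> s) * u_int f V s) * (V (inv f s) * x\<^sup>2 + w\<^sup>2 + z\<^sup>2 - 1),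
     z / sqrt 6 * (1 - 3 * w\<^sup>2 - z\<^sup>2))"
proof -
  define E where "E = V (inv f s) * x\<^sup>2 + w\<^sup>2 + z\<^sup>2 - 1"
  have "(1 - \<psi> s) * theta1 f V s w z + \<psi> s * theta2 f V s x w z =
     sqrt (3/2) * w * (1 - w\<^sup>2 - z\<^sup>2 / 3) - 1/2 * deriv V (inv f s) * x\<^sup>2
       + sqrt (3/2) * ((1 - \<psi> s) * u_int f V s) * E"
  proof (cases "\<psi> s = 1")
    case True
    then show ?thesis by (simp add: theta2_def)
  next
    case False
    then have "\<not> \<bar>s\<bar> \<le> 1 - \<delta>" using cut s by (auto simp: cutoff_def abs_less_iff)
    then have "s \<in> {-1<..<-1+\<delta>} \<union> {1-\<delta><..<1}" using s by auto
    then have Vpos: "V (inv f s) > 0" using cut unfolding cutoff_def by blast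
    have "sqrt (3/2) * u_int f V s * V (inv f s) = 1/2 * deriv V (inv f s)"
      using Vpos by (simp add: sqrt_three_halves u_int_def)
    then have "sqrt (3/2) * u_int f V s * (1 - w\<^sup>2 - z\<^sup>2)
        = 1/2 * deriv V (inv f s) * x\<^sup>2 - sqrt (3/2) * u_int f V s * E"
      unfolding E_def by (simp add: algebra_simps)
    then have "theta1 f V s w z = theta2 f V s x w z + sqrt (3/2) * u_int f V s * E"
      using s by (simp add: theta1_def theta2_def u_ext_def algebra_simps)
    then have "(1 - \<psi> s) * theta1 f V s w z + \<psi> s * theta2 f V s x w z =
        theta2 f V s x w z + sqrt (3/2) * ((1 - \<psi> s) * u_int f V s) * E"
      by (simp add: algebra_simps)
    then show ?thesis by (simp add: theta2_def)
  qed
  then show ?thesis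
    using s by (simp add: vec_field_def speed_ext_def E_def)
qed

lemma phi_component_deriv:
  assumes "(s has_real_derivative deriv f (inv f (s t)) * w) (at t within S)" "\<bar>s t\<bar> < 1"
  shows "((\<lambda>t. inv f (s t)) has_real_derivative w) (at t within S)"
  by (rule DERIV_cong[OF DERIV_chain2[OF inv_f_deriv[OF assms(2)] assms(1)]])
    (use f_deriv(2)[of "inv f (s t)"] in simp)

text \<open>In the coordinate \<open>inv f s\<close> the points -1 and 1 are at infinity, while the
  speed \<open>w\<close> is bounded on a compact time interval by continuity. So \<open>s\<close>
  stays in \<open>{f (-B)..f B}\<close>, which is inside the open interval.\<close>

lemma solution_interior:
  assumes sol: "solution_on f V \<psi> T \<gamma>" and init: "\<bar>fst (\<gamma> 0)\<bar> < 1"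
    and t: "0 \<le> t" "ereal t < T"
  shows "\<bar>fst (\<gamma> t)\<bar> < 1"
proof -
  obtain s x w z where \<gamma>: "\<gamma> = (\<lambda>t. (s t, x t, w t, z t))" by (rule tuple4_fun)
  have deriv: "(\<gamma> has_vector_derivative vec_field f V \<psi> (\<gamma> r)) (at r within {0..t})"
    if "r \<in> {0..t}" for r
    using sol solution_domain_subset[OF t] that unfolding solution_on_def
    by (meson has_vector_derivative_within_subset subsetD)
  have cont: "continuous_on {0..t} \<gamma>"
    using deriv by (rule has_vector_derivative_imp_continuous_on)
  then have conts: "continuous_on {0..t} s" and contw: "continuous_on {0..t} w"
    using continuous_on_fst[OF cont] continuous_on_fst[OF continuous_on_snd[OF continuous_on_snd[OF cont]]]
    by (simp_all add: \<gamma>)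
  obtain K where K: "\<And>r. r \<in> {0..t} \<Longrightarrow> \<bar>w r\<bar> \<le> K"
    using compact_abs_bound[OF compact_Icc contw] by blast
  define B where "B = \<bar>inv f (s 0)\<bar> + K * t"
  have "\<gamma> t \<in> {p. \<bar>fst p\<bar> < 1}"
  proof (rule first_exit[OF cont, where t = t])
    show "open {p :: state. \<bar>fst p\<bar> < 1}" by (intro open_Collect_less continuous_intros)
    fix r assume r: "r \<in> {0..t}" and less: "\<And>q. 0 \<le> q \<Longrightarrow> q < r \<Longrightarrow> \<gamma> q \<in> {p. \<bar>fst p\<bar> < 1}"
    show "\<gamma> r \<in> {p. \<bar>fst p\<bar> < 1}"
    proof (cases "r = 0")
      case True
      then show ?thesis using init by simp
    next
      case False
      \<comment> \<open>The coordinate \<open>inv f s\<close> makes sense only while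
        \<open>s\<close> is interior, hence strictly before \<open>r\<close>; the closed interval
        then carries the bound to \<open>r\<close>.\<close>
      have bd: "s q \<in> {f (-B)..f B}" if q: "q \<in> {0..<r}" for q
      proof -
        have s1: "\<bar>s p\<bar> < 1" if "p \<in> {0..q}" for p
          using less[of p] that q by (simp add: \<gamma>)
        have "((\<lambda>t. inv f (s t)) has_real_derivative w p) (at p within {0..q})"
          if p: "p \<in> {0..q}" for p
        proof (rule phi_component_deriv[where s = s, OF _ s1[OF p]])
          have "(\<gamma> has_vector_derivative vec_field f V \<psi> (\<gamma> p)) (at p within {0..q})"
            using p q r by (intro has_vector_derivative_within_subset[OF deriv]) auto
          then show "(s has_real_derivative deriv f (inv f (s p)) * w p) (at p within {0..q})"
            unfolding \<gamma> vec_field_interior[OF s1[OF p]] has_vector_derivative_tuple4 by blast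
        qed
        then have "norm (inv f (s q) - inv f (s 0)) \<le> K * norm (q - 0)"
          by (rule field_differentiable_bound[rotated]) (use K q r in auto)
        moreover have "K * q \<le> K * t" using K[of 0] q r by (intro mult_left_mono) auto
        ultimately have "- B \<le> inv f (s q)" "inv f (s q) \<le> B"
          using q by (auto simp: B_def)
        then have "f (- B) \<le> f (inv f (s q))" "f (inv f (s q)) \<le> f B"
          using f_mono by (auto simp: strict_mono_less_eq)
        then show ?thesis using f_inv[OF s1[of q]] q by simp
      qed
      have sub: "s ` closure {0..<r} \<subseteq> {f (-B)..f B}"
      proof (rule image_closure_subset)
        show "continuous_on (closure {0..<r}) s"
          using False r by (intro continuous_on_subset[OF conts]) auto
      qed (use bd in auto)
      have "r \<in> closure {0..<r}" using False r by simp
      then have "s r \<in> {f (-B)..f B}" using sub by blast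
      then show ?thesis using f_abs[of B] f_abs[of "-B"] by (auto simp: \<gamma>)
    qed
  qed (use t in auto)
  then show ?thesis by simp
qed

text \<open>Without the constraint at later times the defect \<open>E\<close> still solves a linear
  equation, now with the extra coefficient \<open>6 / sqrt 6 * w * c\<close>.
  \<open>cutoff_regular\<close> bounds \<open>c\<close>, and therefore \<open>E\<close> stays
  0.\<close>

theorem admissible_invariant:
  assumes reg: "cutoff_regular f V \<psi>"
    and sol: "solution_on f V \<psi> T \<gamma>" and init: "\<gamma> 0 \<in> admissible f V"
    and t: "0 \<le> t" "ereal t < T"
  shows "\<gamma> t \<in> admissible f V"
proof -
  obtain s x w z where \<gamma>: "\<gamma> = (\<lambda>t. (s t, x t, w t, z t))" by (rule tuple4_fun)
  have i: "-1 < s 0" "s 0 < 1" "0 < x 0" "V (inv f (s 0)) * (x 0)\<^sup>2 + (w 0)\<^sup>2 + (z 0)\<^sup>2 = 1"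
    using init by (auto simp: \<gamma> admissible_def)
  have s1: "\<bar>s r\<bar> < 1" if "r \<in> {0..t}" for r
    using solution_interior[OF sol _ _ order_le_less_trans[OF _ t(2)], of r] i that
    by (simp add: \<gamma>)
  have deriv: "(\<gamma> has_vector_derivative vec_field f V \<psi> (\<gamma> r)) (at r within {0..t})"
    if "r \<in> {0..t}" for r
    using sol solution_domain_subset[OF t] that unfolding solution_on_def
    by (meson has_vector_derivative_within_subset subsetD)
  define E where "E r = V (inv f (s r)) * (x r)\<^sup>2 + (w r)\<^sup>2 + (z r)\<^sup>2 - 1" for r
  define c where "c r = (1 - \<psi> (s r)) * u_int f V (s r)" for r
  obtain M where M: "\<forall>s\<in>{-1<..<1}. \<bar>(1 - \<psi> s) * u_int f V s\<bar> \<le> M"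
    using reg by (auto simp: cutoff_regular_def bounded_iff)
  have D: "((\<lambda>t. inv f (s t)) has_real_derivative w r) (at r within {0..t})"
    "(x has_real_derivative - (x r / sqrt 6) * (3 * (w r)\<^sup>2 + (z r)\<^sup>2)) (at r within {0..t})"
    "(w has_real_derivative sqrt (3/2) * w r * (1 - (w r)\<^sup>2 - (z r)\<^sup>2 / 3)
        - 1/2 * deriv V (inv f (s r)) * (x r)\<^sup>2 + sqrt (3/2) * c r * E r) (at r within {0..t})"
    "(z has_real_derivative z r / sqrt 6 * (1 - 3 * (w r)\<^sup>2 - (z r)\<^sup>2)) (at r within {0..t})"
    if r: "r \<in> {0..t}" for r
    using deriv[OF r] phi_component_deriv[where s = s, OF _ s1[OF r]]
    unfolding \<gamma> vec_field_interior[OF s1[OF r]] has_vector_derivative_tuple4 c_def E_def by blast+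
  have cont: "continuous_on {0..t} w" "continuous_on {0..t} z"
    using D(3,4) by (meson DERIV_continuous continuous_on_eq_continuous_within)+
  define k where "k r = - 2 * (3 * (w r)\<^sup>2 + (z r)\<^sup>2) / sqrt 6" for r
  have contk: "continuous_on {0..t} k" unfolding k_def by (intro continuous_intros cont) auto
  obtain K where K: "\<And>r. r \<in> {0..t} \<Longrightarrow> \<bar>k r\<bar> \<le> K"
    using compact_abs_bound[OF compact_Icc contk] by blast
  obtain W where W: "\<And>r. r \<in> {0..t} \<Longrightarrow> \<bar>w r\<bar> \<le> W"
    using compact_abs_bound[OF compact_Icc cont(1)] by blast
  have E0: "E t = 0"
  proof (rule linear_ode_bounds(1)[where e = E and a = 0 and b = t])
    fix r assume r: "r \<in> {0..t}"
    note [derivative_intros] = D[OF r] DERIV_chain2[OF C2_realD(1)[OF C2_V] D(1)[OF r]]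
    show "(E has_real_derivative (6 / sqrt 6 * (w r * c r) + k r) * E r) (at r within {0..t})"
      unfolding E_def k_def
      by (rule derivative_eq_intros refl)+
        (simp add: sqrt_three_halves E_def algebra_simps power2_eq_square add_divide_distrib diff_divide_distrib)
    have "\<bar>6 / sqrt 6 * (w r * c r)\<bar> = 6 / sqrt 6 * (\<bar>w r\<bar> * \<bar>c r\<bar>)"
      by (simp add: abs_mult)
    also have "\<dots> \<le> 6 / sqrt 6 * (W * M)"
      using W[OF r] bspec[OF M, of "s r"] s1[OF r]
      by (intro mult_left_mono mult_mono) (auto simp: c_def abs_less_iff)
    finally have "\<bar>6 / sqrt 6 * (w r * c r)\<bar> \<le> 6 / sqrt 6 * (W * M)" .
    then show "\<bar>6 / sqrt 6 * (w r * c r) + k r\<bar> \<le> 6 / sqrt 6 * (W * M) + K"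
      using K[OF r] by linarith
  qed (use t i in \<open>auto simp: E_def\<close>)
  have half: "- (y / sqrt 6) * A = - 2 * A / sqrt 6 / 2 * y" for y A :: real by simp
  have "0 < x t"
  proof (rule linear_ode_continuous_bounds(2)[where e = x and a = 0 and b = t and k = "\<lambda>r. k r / 2"])
    show "(x has_real_derivative k r / 2 * x r) (at r within {0..t})" if "r \<in> {0..t}" for r
      by (rule DERIV_cong[OF D(2)[OF that]]) (simp only: k_def half)
    show "continuous_on {0..t} (\<lambda>r. k r / 2)" by (intro continuous_intros contk) auto
  qed (use t i in auto)
  then show ?thesis
    using E0 s1[of t] t by (auto simp: \<gamma> admissible_def E_def abs_less_iff)
qed

text \<open>The constraint along the whole solution annihilates the defect term of
  \<open>vec_field_interior\<close>; what remains is the field in \<open>\<phi>\<close>.\<close>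

lemma constrained_solution_to_phi:
  assumes sol: "constrained_solution_on f V \<psi> T \<gamma>" and init: "\<gamma> 0 \<in> admissible f V"
    and t: "0 \<le> t" "ereal t < T"
  shows "phi_solution V {0..t} (\<lambda>r. to_phi (\<gamma> r))" "from_phi (to_phi (\<gamma> t)) = \<gamma> t"
proof -
  obtain s x w z where \<gamma>: "\<gamma> = (\<lambda>t. (s t, x t, w t, z t))" by (rule tuple4_fun)
  have sol': "solution_on f V \<psi> T \<gamma>" using sol by (simp add: constrained_solution_on_def)
  have init1: "\<bar>fst (\<gamma> 0)\<bar> < 1" using init by (auto simp: admissible_def)
  have less: "ereal r < T" if "r \<in> {0..t}" for r
    using that order_le_less_trans[OF _ t(2), of "ereal r"] by simp
  have s1: "\<bar>s r\<bar> < 1" if "r \<in> {0..t}" for r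
    using solution_interior[OF sol' init1 _ less[OF that]] that by (simp add: \<gamma>)
  show "from_phi (to_phi (\<gamma> t)) = \<gamma> t"
    using s1[of t] t by (intro from_phi_to_phi) (simp add: \<gamma>)
  have "((\<lambda>r. to_phi (\<gamma> r)) has_vector_derivative phi_field V (to_phi (\<gamma> r))) (at r within {0..t})"
    if r: "r \<in> {0..t}" for r
  proof -
    have E: "V (inv f (s r)) * (x r)\<^sup>2 + (w r)\<^sup>2 + (z r)\<^sup>2 - 1 = 0"
      using sol r less[OF r] s1[OF r] unfolding constrained_solution_on_def constraint_set_def
      by (auto simp: \<gamma>)
    have "(\<gamma> has_vector_derivative vec_field f V \<psi> (\<gamma> r)) (at r within {0..t})"
      using sol' solution_domain_subset[OF t] r unfolding solution_on_def
      by (meson has_vector_derivative_within_subset subsetD)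
    then show ?thesis
      unfolding \<gamma> to_phi_def phi_field_def prod.case vec_field_interior[OF s1[OF r]] E
        has_vector_derivative_tuple4 mult_zero_right add_0_right
      using phi_component_deriv[where s = s, OF _ s1[OF r]] by blast
  qed
  then show "phi_solution V {0..t} (\<lambda>r. to_phi (\<gamma> r))"
    using to_phi_admissible[OF init] by (simp add: phi_solution_def)
qed

lemma phi_solution_admissible:
  assumes g: "phi_solution V {0..} g" and t: "0 \<le> t"
  shows "g t \<in> phi_admissible V"
proof -
  obtain \<phi> x w z where geq: "g = (\<lambda>t. (\<phi> t, x t, w t, z t))" by (rule tuple4_fun)
  obtain C where C: "0 \<le> C" "\<And>t. - C \<le> V t" using V_bounded_below by blast
  have "phi_solution V {0..t} g" by (rule phi_solution_subset[OF g]) auto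
  from phi_solution_bounds(1,2)[OF C2_V C this[unfolded geq] order_refl, of t] t
  show ?thesis by (simp add: geq phi_admissible_def)
qed

lemma phi_solution_from_phi:
  assumes g: "phi_solution V {0..} g"
  shows "constrained_solution_on f V \<psi> \<infinity> (\<lambda>t. from_phi (g t))"
proof -
  obtain \<phi> x w z where geq: "g = (\<lambda>t. (\<phi> t, x t, w t, z t))" by (rule tuple4_fun)
  have E: "V (\<phi> t) * (x t)\<^sup>2 + (w t)\<^sup>2 + (z t)\<^sup>2 - 1 = 0" if "0 \<le> t" for t
    using phi_solution_admissible[OF g that] by (simp add: geq phi_admissible_def)
  have dom: "{\<tau>. 0 \<le> \<tau> \<and> ereal \<tau> < \<infinity>} = {0..}" by auto
  have "((\<lambda>t. from_phi (g t)) has_vector_derivative vec_field f V \<psi> (from_phi (g t))) (at t within {0..})"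
    if t: "t \<in> {0..}" for t
  proof -
    have "(g has_vector_derivative phi_field V (g t)) (at t within {0..})"
      using g t by (simp add: phi_solution_def)
    then have *: "((\<lambda>t. f (\<phi> t)) has_real_derivative deriv f (\<phi> t) * w t) (at t within {0..})"
      unfolding geq phi_field_def prod.case has_vector_derivative_tuple4
      using DERIV_chain2[OF f_deriv(1)] by blast
    show ?thesis
      using \<open>(g has_vector_derivative phi_field V (g t)) (at t within {0..})\<close> * E t
      unfolding geq phi_field_def from_phi_def prod.case vec_field_interior[OF f_abs]
        has_vector_derivative_tuple4 inv_f by simp
  qed
  moreover have "fst (from_phi (g t)) \<in> {-1..1}" for t
    using f_abs[of "\<phi> t"] by (simp add: from_phi_def geq abs_less_iff)
  moreover have "from_phi (g t) \<in> constraint_set f V" if "0 \<le> t" for t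
    using E[OF that] by (simp add: constraint_set_def from_phi_def geq)
  ultimately show ?thesis
    unfolding constrained_solution_on_def solution_on_def dom by auto
qed

end

subsection \<open>Behaviour of x at infinity\<close>

text \<open>Either \<open>g\<close> is bounded on the tail, and levels above \<open>B\<close> do not
  occur there, or it exceeds every \<open>M\<close> and stays above. The same \<open>B\<close> works
  for all \<open>M\<close>.\<close>

lemma increasing_sublevel_bounded_above:
  fixes g :: "real \<Rightarrow> real"
  assumes "\<And>s t. b \<le> s \<Longrightarrow> s \<le> t \<Longrightarrow> g s \<le> g t"
  obtains B where "\<And>M. \<exists>\<beta>. \<forall>t. B < g t \<and> g t \<le> M \<longrightarrow> t \<le> \<beta>"
proof (cases "\<exists>B. \<forall>t\<ge>b. g t \<le> B")
  case True
  then obtain B where B: "\<And>t. t \<ge> b \<Longrightarrow> g t \<le> B" by blast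
  have "t \<le> b" if "B < g t" for t
    using B[of t] that by (cases "b \<le> t") auto
  then show ?thesis using that by blast
next
  case False
  have "\<exists>\<beta>. \<forall>t. 0 < g t \<and> g t \<le> M \<longrightarrow> t \<le> \<beta>" for M
  proof -
    obtain \<beta> where "\<beta> \<ge> b" "g \<beta> > M" using False by (meson not_le)
    have "t \<le> \<beta>" if "g t \<le> M" for t
    proof (rule ccontr)
      assume "\<not> t \<le> \<beta>"
      then have "g \<beta> \<le> g t" using \<open>\<beta> \<ge> b\<close> by (intro assms) auto
      then show False using that \<open>g \<beta> > M\<close> by simp
    qed
    then show ?thesis by blast
  qed
  then show ?thesis using that by blast
qed

context compactified_potential
begin

section \<open>Growth and slope of the potential at infinity\<close>

lemma V_tails:
  "\<exists>a b. (\<forall>t\<le>a. V t > 0 \<and> deriv V t < 0) \<and> (\<forall>t\<ge>b. V t > 0 \<and> deriv V t > 0)"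
  using V unfolding assumption_V_def eventually_at_bot_linorder eventually_at_top_linorder
  by blast

text \<open>The points where \<open>V\<close> is close to a level above \<open>K\<close> form a
  compact set outside \<open>{a..b}\<close>, and there the derivative has no zero. Tails on which
  \<open>V\<close> stays bounded could have slopes tending to 0; \<open>K\<close> lies above
  them.\<close>

lemma V_steep_at_high_levels:
  obtains K where "K > 0"
    "\<And>v. v > K \<Longrightarrow> \<exists>\<epsilon>>0. \<exists>c>0. \<forall>t. \<bar>V t - v\<bar> \<le> \<epsilon> \<longrightarrow> c \<le> \<bar>deriv V t\<bar>"
proof -
  obtain a b where tails: "\<forall>t\<le>a. V t > 0 \<and> deriv V t < 0" "\<forall>t\<ge>b. V t > 0 \<and> deriv V t > 0"
    using V_tails by blast
  then have ab:
    "\<And>t. t \<le> a \<Longrightarrow> V t > 0" "\<And>t. t \<le> a \<Longrightarrow> deriv V t < 0"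
    "\<And>t. t \<ge> b \<Longrightarrow> V t > 0" "\<And>t. t \<ge> b \<Longrightarrow> deriv V t > 0"
    by auto
  have incr: "V s \<le> V t" if "b \<le> s" "s \<le> t" for s t
  proof (rule DERIV_nonneg_imp_nondecreasing[OF that(2)])
    show "\<exists>y. (V has_real_derivative y) (at r) \<and> 0 \<le> y" if "s \<le> r" for r
      using C2_realD(1)[OF C2_V, of r] ab(4)[of r] \<open>b \<le> s\<close> that by (intro exI conjI) auto
  qed
  \<comment> \<open>Reflecting the left tail makes it increasing, so that the same lemma
    applies.\<close>
  have decr: "V (- s) \<le> V (- t)" if "- a \<le> s" "s \<le> t" for s t
  proof (rule DERIV_nonpos_imp_nonincreasing[where f = V and a = "- t" and b = "- s"])
    show "- t \<le> - s" using that by simp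
    show "\<exists>y. (V has_real_derivative y) (at r) \<and> y \<le> 0" if "r \<le> - s" for r
      using C2_realD(1)[OF C2_V, of r] ab(2)[of r] \<open>- a \<le> s\<close> that by (intro exI conjI) auto
  qed
  obtain B1 where B1: "\<And>M. \<exists>\<beta>. \<forall>t. B1 < V t \<and> V t \<le> M \<longrightarrow> t \<le> \<beta>"
    using increasing_sublevel_bounded_above[where g = V, OF incr] by blast
  obtain B2 where B2: "\<And>M. \<exists>\<beta>. \<forall>t. B2 < V (- t) \<and> V (- t) \<le> M \<longrightarrow> t \<le> \<beta>"
    using increasing_sublevel_bounded_above[where g = "\<lambda>t. V (- t)", OF decr] by blast
  obtain B3 where B3: "\<And>t. t \<in> {a..b} \<Longrightarrow> \<bar>V t\<bar> \<le> B3"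
    using compact_abs_bound[OF compact_Icc[of a b] continuous_on_subset[OF C2_realD(5)[OF C2_V] subset_UNIV]]
    by blast
  \<comment> \<open>The entry 1 makes \<open>K\<close> positive; \<open>B1\<close> and
    \<open>B2\<close> bar escape to either end, and \<open>B3\<close> keeps \<open>{a..b}\<close>
    below the level.\<close>
  define K where "K = Max {1, B1, B2, B3}"
  have K: "1 \<le> K" "B1 \<le> K" "B2 \<le> K" "B3 \<le> K" by (simp_all add: K_def)
  have "\<exists>\<epsilon>>0. \<exists>c>0. \<forall>t. \<bar>V t - v\<bar> \<le> \<epsilon> \<longrightarrow> c \<le> \<bar>deriv V t\<bar>" if v: "v > K" for v
  proof -
    \<comment> \<open>Half the gap, so that the whole band around \<open>v\<close> remains above
      \<open>K\<close>.\<close>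
    define \<epsilon> where "\<epsilon> = (v - K) / 2"
    define S where "S = {t. \<bar>V t - v\<bar> \<le> \<epsilon>}"
    have SK: "V t > K" "V t \<le> v + \<epsilon>" if "t \<in> S" for t
    proof -
      have "V t \<le> v + \<epsilon>" "v - \<epsilon> \<le> V t" using that by (auto simp: S_def abs_le_iff)
      moreover have "K < v - \<epsilon>" using v by (simp add: \<epsilon>_def field_simps)
      ultimately show "V t > K" "V t \<le> v + \<epsilon>" by auto
    qed
    obtain \<beta> where \<beta>: "\<And>t. B1 < V t \<Longrightarrow> V t \<le> v + \<epsilon> \<Longrightarrow> t \<le> \<beta>" using B1 by blast
    obtain \<alpha> where \<alpha>: "\<And>t. B2 < V (- t) \<Longrightarrow> V (- t) \<le> v + \<epsilon> \<Longrightarrow> t \<le> \<alpha>" using B2 by blast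
    have "S \<subseteq> {-\<alpha>..\<beta>}"
    proof
      fix t assume t: "t \<in> S"
      have "t \<le> \<beta>" using \<beta> SK[OF t] K by simp
      moreover have "- t \<le> \<alpha>" using \<alpha>[of "- t"] SK[OF t] K by simp
      ultimately show "t \<in> {-\<alpha>..\<beta>}" by simp
    qed
    moreover have "closed S"
      unfolding S_def by (intro closed_Collect_le continuous_intros C2_realD(5)[OF C2_V])
    ultimately have "compact S"
      using compact_Int_closed[OF compact_Icc[of "-\<alpha>" \<beta>]] by (metis inf.absorb2)
    have nz: "deriv V t \<noteq> 0" if "t \<in> S" for t
    proof -
      have "t \<notin> {a..b}" using B3[of t] SK[OF that] K by auto
      then show ?thesis using ab(2)[of t] ab(4)[of t] by force
    qed
    have "\<exists>c>0. \<forall>t\<in>S. c \<le> \<bar>deriv V t\<bar>"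
    proof (cases "S = {}")
      case True
      then show ?thesis by (auto intro: exI[of _ 1])
    next
      case False
      have "continuous_on S (\<lambda>t. \<bar>deriv V t\<bar>)"
        by (intro continuous_intros continuous_on_subset[OF C2_realD(4)[OF C2_V] subset_UNIV])
      from continuous_attains_inf[OF \<open>compact S\<close> False this] obtain r
        where "r \<in> S" "\<forall>t\<in>S. \<bar>deriv V r\<bar> \<le> \<bar>deriv V t\<bar>" by blast
      then show ?thesis using nz[of r] by (intro exI[of _ "\<bar>deriv V r\<bar>"]) simp
    qed
    then show ?thesis using v by (intro exI[of _ \<epsilon>]) (auto simp: S_def \<epsilon>_def)
  qed
  then show ?thesis using that[of K] K by simp
qed

text \<open>Near both ends the finite limits of \<open>u\<close> bound the logarithmic derivative of
  \<open>V\<close>; the middle part is compact, where the summand 1 absorbs zeros of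
  \<open>V\<close>.\<close>

lemma deriv_V_bound:
  obtains C where "0 \<le> C" "\<And>t. \<bar>deriv V t\<bar> \<le> C * (1 + \<bar>V t\<bar>)"
proof -
  obtain a b where tails: "\<forall>t\<le>a. V t > 0 \<and> deriv V t < 0" "\<forall>t\<ge>b. V t > 0 \<and> deriv V t > 0"
    using V_tails by blast
  then have ab:
    "\<And>t. t \<le> a \<Longrightarrow> V t > 0" "\<And>t. t \<le> a \<Longrightarrow> deriv V t < 0"
    "\<And>t. t \<ge> b \<Longrightarrow> V t > 0" "\<And>t. t \<ge> b \<Longrightarrow> deriv V t > 0"
    by auto
  have step: "\<bar>deriv V t\<bar> \<le> (sqrt 6 * M) * V t" if "\<bar>u_int f V (f t)\<bar> \<le> M" "V t > 0" for t M
    using that by (simp add: u_int_def abs_divide abs_mult divide_le_eq mult_ac)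
  obtain l1 l2 where l: "(u_int f V \<longlongrightarrow> l1) (at_right (-1))" "(u_int f V \<longlongrightarrow> l2) (at_left 1)"
    using V by (auto simp: assumption_V_def)
  have "\<forall>\<^sub>F s in at_right (-1). \<bar>u_int f V s\<bar> < \<bar>l1\<bar> + 1"
    using tendsto_rabs[OF l(1)] by (rule order_tendstoD) simp
  then obtain \<sigma> where \<sigma>: "\<sigma> > -1" "\<And>s. -1 < s \<Longrightarrow> s < \<sigma> \<Longrightarrow> \<bar>u_int f V s\<bar> < \<bar>l1\<bar> + 1"
    unfolding eventually_at_right_field by blast
  have "\<forall>\<^sub>F s in at_left 1. \<bar>u_int f V s\<bar> < \<bar>l2\<bar> + 1"
    using tendsto_rabs[OF l(2)] by (rule order_tendstoD) simp
  then obtain \<rho> where \<rho>: "\<rho> < 1" "\<And>s. \<rho> < s \<Longrightarrow> s < 1 \<Longrightarrow> \<bar>u_int f V s\<bar> < \<bar>l2\<bar> + 1"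
    unfolding eventually_at_left_field by blast
  \<comment> \<open>The minimum with 0 keeps the argument of \<open>inv f\<close> inside the open
    interval; \<open>max \<rho> 0\<close> below does the same.\<close>
  define \<alpha> where "\<alpha> = min a (inv f (min \<sigma> 0))"
  define \<beta> where "\<beta> = max b (inv f (max \<rho> 0))"
  have left: "\<bar>deriv V t\<bar> \<le> (sqrt 6 * (\<bar>l1\<bar> + 1)) * V t" if "t < \<alpha>" for t
  proof (rule step)
    have "f t < f (inv f (min \<sigma> 0))"
      using that f_mono by (auto simp: \<alpha>_def strict_mono_less)
    also have "f (inv f (min \<sigma> 0)) = min \<sigma> 0" using \<sigma>(1) by (intro f_inv) auto
    finally show "\<bar>u_int f V (f t)\<bar> \<le> \<bar>l1\<bar> + 1"
      using f_abs[of t] by (intro less_imp_le \<sigma>(2)) auto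
  qed (use that ab in \<open>simp add: \<alpha>_def\<close>)
  have right: "\<bar>deriv V t\<bar> \<le> (sqrt 6 * (\<bar>l2\<bar> + 1)) * V t" if "t > \<beta>" for t
  proof (rule step)
    have "f (inv f (max \<rho> 0)) = max \<rho> 0" using \<rho>(1) by (intro f_inv) auto
    moreover have "f (inv f (max \<rho> 0)) < f t"
      using that f_mono by (auto simp: \<beta>_def strict_mono_less)
    ultimately show "\<bar>u_int f V (f t)\<bar> \<le> \<bar>l2\<bar> + 1"
      using f_abs[of t] by (intro less_imp_le \<rho>(2)) auto
  qed (use that ab in \<open>simp add: \<beta>_def\<close>)
  obtain B where B: "\<And>t. t \<in> {\<alpha>..\<beta>} \<Longrightarrow> \<bar>deriv V t\<bar> \<le> B"
    using compact_abs_bound[OF compact_Icc[of \<alpha> \<beta>] continuous_on_subset[OF C2_realD(4)[OF C2_V] subset_UNIV]]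
    by blast
  define C where "C = sqrt 6 * (\<bar>l1\<bar> + 1) + sqrt 6 * (\<bar>l2\<bar> + 1) + \<bar>B\<bar>"
  have C: "0 \<le> C" "sqrt 6 * (\<bar>l1\<bar> + 1) \<le> C" "sqrt 6 * (\<bar>l2\<bar> + 1) \<le> C" "B \<le> C"
  proof -
    have "0 \<le> sqrt 6 * (\<bar>l1\<bar> + 1)" "0 \<le> sqrt 6 * (\<bar>l2\<bar> + 1)" by simp_all
    then show "0 \<le> C" "sqrt 6 * (\<bar>l1\<bar> + 1) \<le> C" "sqrt 6 * (\<bar>l2\<bar> + 1) \<le> C" "B \<le> C"
      unfolding C_def by linarith+
  qed
  show ?thesis
  proof
    fix t
    have le: "C * \<bar>V t\<bar> \<le> C * (1 + \<bar>V t\<bar>)" "C \<le> C * (1 + \<bar>V t\<bar>)"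
      using C(1) by (simp_all add: distrib_left)
    consider "t < \<alpha>" | "t > \<beta>" | "t \<in> {\<alpha>..\<beta>}" by fastforce
    then show "\<bar>deriv V t\<bar> \<le> C * (1 + \<bar>V t\<bar>)"
    proof cases
      case 1
      have "(sqrt 6 * (\<bar>l1\<bar> + 1)) * V t \<le> C * \<bar>V t\<bar>"
        using ab(1)[of t] 1 C by (intro mult_mono) (auto simp: \<alpha>_def)
      then show ?thesis using left[OF 1] le by linarith
    next
      case 2
      have "(sqrt 6 * (\<bar>l2\<bar> + 1)) * V t \<le> C * \<bar>V t\<bar>"
        using ab(3)[of t] 2 C by (intro mult_mono) (auto simp: \<beta>_def)
      then show ?thesis using right[OF 2] le by linarith
    next
      case 3
      then show ?thesis using B[OF 3] C le by linarith
    qed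
  qed (rule C)
qed

section \<open>Asymptotics of solutions for all times\<close>

lemma phi_solution_global:
  assumes g: "phi_solution V {0..} (\<lambda>t. (\<phi> t, x t, w t, z t))" and t: "0 \<le> t"
  shows "V (\<phi> t) * (x t)\<^sup>2 + (w t)\<^sup>2 + (z t)\<^sup>2 = 1" "0 < x t"
  using phi_solution_admissible[OF g t] by (auto simp: phi_admissible_def)

lemma phi_solution_deriv_at:
  assumes g: "phi_solution V {0..} (\<lambda>t. (\<phi> t, x t, w t, z t))" and t: "0 < t"
  shows "(x has_real_derivative (- (3 * (w t)\<^sup>2 + (z t)\<^sup>2) / sqrt 6) * x t) (at t)"
    and "(w has_real_derivative sqrt (3/2) * w t * (1 - (w t)\<^sup>2 - (z t)\<^sup>2 / 3)
           - 1/2 * deriv V (\<phi> t) * (x t)\<^sup>2) (at t)"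
proof -
  have "at t within {0..} = at t" using t by (intro at_within_interior) simp
  then show "(x has_real_derivative (- (3 * (w t)\<^sup>2 + (z t)\<^sup>2) / sqrt 6) * x t) (at t)"
    "(w has_real_derivative sqrt (3/2) * w t * (1 - (w t)\<^sup>2 - (z t)\<^sup>2 / 3)
           - 1/2 * deriv V (\<phi> t) * (x t)\<^sup>2) (at t)"
    using phi_solution_tuple(2,3)[OF g, of t] t by auto
qed

lemma phi_solution_antimono:
  assumes g: "phi_solution V {0..} (\<lambda>t. (\<phi> t, x t, w t, z t))" and st: "0 \<le> s" "s \<le> t"
  shows "x t \<le> x s"
proof -
  have sub: "{s..t} \<subseteq> {0..}" using st by auto
  have "x t \<le> x s * exp (0 * (t - s))"
  proof (rule gronwall_real[OF DERIV_subset[OF phi_solution_tuple(2)[OF g] sub]])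
    fix r assume r: "r \<in> {s..t}"
    have "0 < x r" using phi_solution_global(2)[OF g, of r] r st by simp
    then show "(- (3 * (w r)\<^sup>2 + (z r)\<^sup>2) / sqrt 6) * x r \<le> 0 * x r"
      using zero_le_power2[of "w r"] zero_le_power2[of "z r"]
      by (intro mult_right_mono divide_nonpos_nonneg) (linarith | simp)+
  qed (use st sub in auto)
  then show ?thesis by simp
qed

text \<open>By the constraint \<open>1 - w\<^sup>2 - z\<^sup>2\<close> is
  \<open>V * x\<^sup>2\<close>, so its bound controls the potential term even if
  \<open>\<phi>\<close> is unbounded; the last quantity is a factor in the equation for
  \<open>w\<close>.\<close>

lemma phi_solution_global_bounds:
  assumes g: "phi_solution V {0..} (\<lambda>t. (\<phi> t, x t, w t, z t))"
  shows "\<exists>B. \<forall>t\<ge>0. \<bar>w t\<bar> \<le> B \<and> \<bar>z t\<bar> \<le> B \<and>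
    \<bar>1 - (w t)\<^sup>2 - (z t)\<^sup>2\<bar> \<le> B \<and> \<bar>1 - (w t)\<^sup>2 - (z t)\<^sup>2 / 3\<bar> \<le> B"
proof -
  obtain C where C: "0 \<le> C" "\<And>t. - C \<le> V t" using V_bounded_below by blast
  define B where "B = 1 + C * (x 0)\<^sup>2"
  have B1: "1 \<le> B" using C by (simp add: B_def)
  have *: "(w t)\<^sup>2 + (z t)\<^sup>2 \<le> B" if "0 \<le> t" for t
  proof -
    have "phi_solution V {0..t} (\<lambda>t. (\<phi> t, x t, w t, z t))" by (rule phi_solution_subset[OF g]) auto
    from phi_solution_bounds(4)[OF C2_V C this order_refl] that show ?thesis by (simp add: B_def)
  qed
  have sq: "(w t)\<^sup>2 \<le> B" "(z t)\<^sup>2 \<le> B" if "0 \<le> t" for t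
    using *[OF that] zero_le_power2[of "w t"] zero_le_power2[of "z t"] by linarith+
  have "\<bar>w t\<bar> \<le> B" "\<bar>z t\<bar> \<le> B" if t: "0 \<le> t" for t
    using abs_le_of_square_le sq[OF t] B1 by blast+
  moreover have "\<bar>1 - (w t)\<^sup>2 - (z t)\<^sup>2\<bar> \<le> B" "\<bar>1 - (w t)\<^sup>2 - (z t)\<^sup>2 / 3\<bar> \<le> B" if t: "0 \<le> t" for t
    using *[OF t] B1 zero_le_power2[of "w t"] zero_le_power2[of "z t"] unfolding abs_le_iff
    by linarith+
  ultimately show ?thesis by blast
qed

lemma x_tendsto_0_of_z_nonzero:
  assumes g: "phi_solution V {0..} (\<lambda>t. (\<phi> t, x t, w t, z t))" and z0: "z 0 \<noteq> 0"
  shows "(x \<longlongrightarrow> 0) at_top"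
proof -
  obtain B where B: "\<And>t. 0 \<le> t \<Longrightarrow> \<bar>z t\<bar> \<le> B" using phi_solution_global_bounds[OF g] by blast
  \<comment> \<open>The rate \<open>1 / sqrt 6\<close> is the difference of the logarithmic
    derivatives of \<open>z\<close> and \<open>x\<close>. Written without a quotient, the relation
    is a function that vanishes at 0 and solves the linear equation of \<open>z\<close>.\<close>
  have eq: "z t * x 0 - z 0 * x t * exp (t / sqrt 6) = 0" if t: "0 \<le> t" for t
  proof (rule linear_ode_continuous_bounds(1)[where a = 0 and b = t
        and e = "\<lambda>t. z t * x 0 - z 0 * x t * exp (t / sqrt 6)"
        and k = "\<lambda>t. (1 - 3 * (w t)\<^sup>2 - (z t)\<^sup>2) / sqrt 6"])
    have g': "phi_solution V {0..t} (\<lambda>t. (\<phi> t, x t, w t, z t))"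
      by (rule phi_solution_subset[OF g]) auto
    show "((\<lambda>t. z t * x 0 - z 0 * x t * exp (t / sqrt 6)) has_real_derivative
        (1 - 3 * (w r)\<^sup>2 - (z r)\<^sup>2) / sqrt 6 * (z r * x 0 - z 0 * x r * exp (r / sqrt 6)))
        (at r within {0..t})" if r: "r \<in> {0..t}" for r
    proof -
      have e: "((\<lambda>t. exp (t / sqrt 6)) has_real_derivative exp (r / sqrt 6) / sqrt 6) (at r within {0..t})"
        by (rule DERIV_cong[OF DERIV_chain2[OF DERIV_exp DERIV_cdivide[OF DERIV_ident]]]) simp
      define k where "k = (1 - 3 * (w r)\<^sup>2 - (z r)\<^sup>2) / sqrt 6"
      have k: "- (3 * (w r)\<^sup>2 + (z r)\<^sup>2) / sqrt 6 = k - 1 / sqrt 6"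
        by (simp add: k_def flip: diff_divide_distrib)
      note d = DERIV_diff[OF DERIV_cmult_right[OF phi_solution_tuple(4)[OF g' r]]
          DERIV_mult[OF DERIV_cmult[OF phi_solution_tuple(2)[OF g' r, unfolded k]] e], folded k_def]
      show ?thesis
        unfolding k_def[symmetric] by (rule DERIV_cong[OF d]) (simp add: algebra_simps)
    qed
    have "continuous_on {0..t} w" "continuous_on {0..t} z"
      using phi_solution_tuple(3,4)[OF g'] by (meson DERIV_continuous continuous_on_eq_continuous_within)+
    then show "continuous_on {0..t} (\<lambda>t. (1 - 3 * (w t)\<^sup>2 - (z t)\<^sup>2) / sqrt 6)"
      by (intro continuous_intros) auto
  qed (use t in auto)
  have bd: "norm (x t) \<le> (B * x 0 / \<bar>z 0\<bar>) * exp (- (t / sqrt 6))" if t: "0 \<le> t" for t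
  proof -
    have x0: "0 < x 0" by (rule phi_solution_global(2)[OF g]) simp
    have "\<bar>z 0\<bar> * \<bar>x t\<bar> * exp (t / sqrt 6) = \<bar>z 0 * x t * exp (t / sqrt 6)\<bar>"
      by (simp add: abs_mult)
    also have "\<dots> = \<bar>z t * x 0\<bar>" using eq[OF t] by simp
    also have "\<dots> \<le> B * x 0" using B[OF t] x0 by (simp add: abs_mult)
    finally have "\<bar>x t\<bar> * exp (t / sqrt 6) \<le> B * x 0 / \<bar>z 0\<bar>"
      using z0 by (simp add: field_simps)
    then have "\<bar>x t\<bar> * exp (t / sqrt 6) * exp (- (t / sqrt 6)) \<le> (B * x 0 / \<bar>z 0\<bar>) * exp (- (t / sqrt 6))"
      by (rule mult_right_mono) simp
    then show ?thesis by (simp add: mult.assoc flip: exp_add)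
  qed
  have "filterlim (\<lambda>t::real. 1 / sqrt 6 * t) at_top at_top"
    by (rule filterlim_tendsto_pos_mult_at_top[OF tendsto_const _ filterlim_ident]) simp
  then have "filterlim (\<lambda>t::real. - (t / sqrt 6)) at_bot at_top"
    by (simp add: filterlim_uminus_at_bot)
  from tendsto_mult[OF tendsto_const filterlim_compose[OF exp_at_bot this]]
  have "((\<lambda>t::real. a * exp (- (t / sqrt 6))) \<longlongrightarrow> 0) at_top" for a
    by simp
  moreover have ev: "\<forall>\<^sub>F t in at_top. norm (x t) \<le> (B * x 0 / \<bar>z 0\<bar>) * exp (- (t / sqrt 6))"
    using eventually_ge_at_top[of 0] by eventually_elim (rule bd)
  ultimately show ?thesis using Lim_null_comparison[OF ev] by blast
qed

text \<open>The term with \<open>deriv V\<close> is at most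
  \<open>C * (x\<^sup>2 + \<bar>V\<bar> * x\<^sup>2)\<close> by \<open>deriv_V_bound\<close>, and
  both summands are bounded along the solution.\<close>

lemma w_deriv_bound:
  assumes g: "phi_solution V {0..} (\<lambda>t. (\<phi> t, x t, w t, z t))"
  obtains D where "D > 0"
    "\<And>t. 0 \<le> t \<Longrightarrow> \<bar>sqrt (3/2) * w t * (1 - (w t)\<^sup>2 - (z t)\<^sup>2 / 3) - 1/2 * deriv V (\<phi> t) * (x t)\<^sup>2\<bar> \<le> D"
proof -
  obtain B where B: "\<And>t. 0 \<le> t \<Longrightarrow> \<bar>w t\<bar> \<le> B"
    "\<And>t. 0 \<le> t \<Longrightarrow> \<bar>1 - (w t)\<^sup>2 - (z t)\<^sup>2\<bar> \<le> B" "\<And>t. 0 \<le> t \<Longrightarrow> \<bar>1 - (w t)\<^sup>2 - (z t)\<^sup>2 / 3\<bar> \<le> B"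
    using phi_solution_global_bounds[OF g] by blast
  obtain C where C: "0 \<le> C" "\<And>t. \<bar>deriv V t\<bar> \<le> C * (1 + \<bar>V t\<bar>)" using deriv_V_bound by blast
  define D where "D = sqrt (3/2) * (B * B) + C * ((x 0)\<^sup>2 + B) + 1"
  have B0: "0 \<le> B" using B(1)[of 0] by simp
  have D: "\<bar>sqrt (3/2) * w t * (1 - (w t)\<^sup>2 - (z t)\<^sup>2 / 3) - 1/2 * deriv V (\<phi> t) * (x t)\<^sup>2\<bar> \<le> D"
    if t: "0 \<le> t" for t
  proof -
    have 1: "\<bar>sqrt (3/2) * w t * (1 - (w t)\<^sup>2 - (z t)\<^sup>2 / 3)\<bar> \<le> sqrt (3/2) * (B * B)"
      unfolding abs_mult mult.assoc using B(1,3)[OF t] B0 by (intro mult_mono) auto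
    have x: "0 < x t" "x t \<le> x 0"
      using phi_solution_global(2)[OF g t] phi_solution_antimono[OF g _ t] by auto
    have "V (\<phi> t) * (x t)\<^sup>2 = 1 - (w t)\<^sup>2 - (z t)\<^sup>2" using phi_solution_global(1)[OF g t] by simp
    then have Vx: "\<bar>V (\<phi> t)\<bar> * (x t)\<^sup>2 \<le> B"
      using B(2)[OF t] abs_mult[of "V (\<phi> t)" "(x t)\<^sup>2"] by simp
    have "\<bar>deriv V (\<phi> t) * (x t)\<^sup>2\<bar> \<le> C * (1 + \<bar>V (\<phi> t)\<bar>) * (x t)\<^sup>2"
      unfolding abs_mult abs_power2 using C(2) by (intro mult_right_mono) auto
    also have "\<dots> = C * ((x t)\<^sup>2 + \<bar>V (\<phi> t)\<bar> * (x t)\<^sup>2)" by (simp add: algebra_simps)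
    also have "\<dots> \<le> C * ((x 0)\<^sup>2 + B)"
      using C(1) x Vx by (intro mult_left_mono add_mono power_mono) auto
    finally have 2: "\<bar>deriv V (\<phi> t) * (x t)\<^sup>2\<bar> \<le> C * ((x 0)\<^sup>2 + B)" .
    have "\<bar>1/2 * deriv V (\<phi> t) * (x t)\<^sup>2\<bar> \<le> \<bar>deriv V (\<phi> t) * (x t)\<^sup>2\<bar>" by simp
    with 1 2 show ?thesis unfolding D_def by linarith
  qed
  have "0 \<le> sqrt (3/2) * (B * B)" "0 \<le> C * ((x 0)\<^sup>2 + B)" using B0 C by simp_all
  then have "D > 0" unfolding D_def by linarith
  then show ?thesis using D that by blast
qed

text \<open>A Barbalat argument: \<open>w\<close> varies at a bounded rate, so a late value of size
  \<open>\<epsilon>\<close> persists for a fixed time, during which \<open>x\<close> loses a fixed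
  amount. Near its limit \<open>x\<close> has no such amount left.\<close>

lemma w_tendsto_0:
  assumes g: "phi_solution V {0..} (\<lambda>t. (\<phi> t, x t, w t, z t))"
    and lim: "(x \<longlongrightarrow> l) at_top" and l: "l > 0"
  shows "(w \<longlongrightarrow> 0) at_top"
proof (rule tendstoI)
  fix \<epsilon> :: real assume \<epsilon>: "\<epsilon> > 0"
  obtain D where D: "D > 0"
    "\<And>t. 0 \<le> t \<Longrightarrow> \<bar>sqrt (3/2) * w t * (1 - (w t)\<^sup>2 - (z t)\<^sup>2 / 3) - 1/2 * deriv V (\<phi> t) * (x t)\<^sup>2\<bar> \<le> D"
    using w_deriv_bound[OF g] by blast
  \<comment> \<open>At rate \<open>D\<close> the value of \<open>w\<close> changes by at most
    \<open>\<epsilon> / 2\<close> within time \<open>h\<close>.\<close>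
  define h where "h = \<epsilon> / (2 * D)"
  have h: "h > 0" using \<epsilon> D by (simp add: h_def)
  \<comment> \<open>The least loss of \<open>x\<close> over a window of length \<open>h\<close> on
    which \<open>\<bar>w\<bar> \<ge> \<epsilon> / 2\<close> and \<open>x \<ge> l\<close>.\<close>
  define \<kappa> where "\<kappa> = h * (3 * (\<epsilon> / 2)\<^sup>2 / sqrt 6 * l)"
  have \<kappa>: "\<kappa> > 0" using h \<epsilon> l by (simp add: \<kappa>_def)
  have xl: "l \<le> x t" if "0 \<le> t" for t
  proof (rule tendsto_upperbound[OF lim])
    show "\<forall>\<^sub>F s in at_top. x s \<le> x t"
      using eventually_ge_at_top[of t] by eventually_elim (rule phi_solution_antimono[OF g that])
  qed simp
  have "\<forall>\<^sub>F t in at_top. x t < l + \<kappa>"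
    using order_tendstoD(2)[OF lim, of "l + \<kappa>"] \<kappa> by simp
  then show "\<forall>\<^sub>F t in at_top. dist (w t) 0 < \<epsilon>"
    using eventually_gt_at_top[of 0]
  proof eventually_elim
    case (elim t)
    show ?case
    proof (rule ccontr)
      assume "\<not> dist (w t) 0 < \<epsilon>"
      then have wt: "\<epsilon> \<le> \<bar>w t\<bar>" by simp
      obtain \<xi> where \<xi>: "t < \<xi>" "\<xi> < t + h"
        "x (t + h) - x t = (t + h - t) * ((- (3 * (w \<xi>)\<^sup>2 + (z \<xi>)\<^sup>2) / sqrt 6) * x \<xi>)"
        using MVT2[of t "t + h" x, OF _ phi_solution_deriv_at(1)[OF g]] h elim(2) by auto
      obtain \<eta> where \<eta>: "t < \<eta>" "\<eta> < \<xi>"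
        "w \<xi> - w t = (\<xi> - t) * (sqrt (3/2) * w \<eta> * (1 - (w \<eta>)\<^sup>2 - (z \<eta>)\<^sup>2 / 3)
           - 1/2 * deriv V (\<phi> \<eta>) * (x \<eta>)\<^sup>2)"
        using MVT2[of t \<xi> w, OF _ phi_solution_deriv_at(2)[OF g]] \<xi>(1) elim(2) by auto
      have "\<bar>w \<xi> - w t\<bar> \<le> h * D"
        unfolding \<eta>(3) abs_mult[of "\<xi> - t"] using D(2)[of \<eta>] \<eta>(1) \<xi>(1,2) elim(2)
        by (intro mult_mono) auto
      also have "\<dots> = \<epsilon> / 2" using D(1) by (simp add: h_def)
      finally have "\<epsilon> / 2 \<le> \<bar>w \<xi>\<bar>" using wt by linarith
      then have "(\<epsilon> / 2)\<^sup>2 \<le> (w \<xi>)\<^sup>2" 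
        using \<epsilon> power_mono[of "\<epsilon> / 2" "\<bar>w \<xi>\<bar>" 2] by simp
      then have "3 * (\<epsilon> / 2)\<^sup>2 / sqrt 6 * l \<le> (3 * (w \<xi>)\<^sup>2 + (z \<xi>)\<^sup>2) / sqrt 6 * x \<xi>"
        using xl[of \<xi>] \<xi>(1) elim(2) l
        by (intro mult_mono divide_right_mono) (auto intro: add_increasing2)
      then have "\<kappa> \<le> h * ((3 * (w \<xi>)\<^sup>2 + (z \<xi>)\<^sup>2) / sqrt 6 * x \<xi>)"
        unfolding \<kappa>_def using h by (intro mult_left_mono) auto
      also have "\<dots> = x t - x (t + h)"
      proof -
        have "x t - x (t + h) = h * (A / sqrt 6 * y)"
          if "x (t + h) - x t = (t + h - t) * ((- A / sqrt 6) * y)" for A y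
          using that by simp
        from this[OF \<xi>(3)] show ?thesis by (rule sym)
      qed
      also have "\<dots> \<le> x t - l" using xl[of "t + h"] h elim(2) by simp
      finally show False using elim(1) by simp
    qed
  qed
qed

lemma x_limit:
  assumes g: "phi_solution V {0..} (\<lambda>t. (\<phi> t, x t, w t, z t))"
  obtains l where "(x \<longlongrightarrow> l) at_top" "0 \<le> l" "\<And>t. 0 \<le> t \<Longrightarrow> l \<le> x t"
proof -
  define l where "l = Inf (x ` {0..})"
  have bdd: "bdd_below (x ` {0..})"
    using phi_solution_global(2)[OF g] by (intro bdd_belowI[of _ 0]) force
  have lb: "l \<le> x t" if "0 \<le> t" for t
    unfolding l_def using that by (intro cInf_lower bdd) auto
  have "0 \<le> l"
    unfolding l_def using phi_solution_global(2)[OF g] by (intro cInf_greatest) force+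
  moreover have "(x \<longlongrightarrow> l) at_top"
  proof (rule decreasing_tendsto)
    show "\<forall>\<^sub>F t in at_top. l \<le> x t" using eventually_ge_at_top[of 0] by eventually_elim (rule lb)
    fix y assume "l < y"
    then obtain s where s: "0 \<le> s" "x s < y"
      unfolding l_def using cInf_less_iff[of "x ` {0..}" y] bdd by auto
    show "\<forall>\<^sub>F t in at_top. x t < y"
      using eventually_ge_at_top[of s]
    proof eventually_elim
      case (elim t)
      show ?case using phi_solution_antimono[OF g s(1) elim] s(2) by simp
    qed
  qed
  ultimately show ?thesis using lb that by blast
qed

text \<open>Once \<open>1/x\<^sup>2\<close> exceeds the critical level, a positive limit of \<open>x\<close> would force \<open>w \<rightarrow> 0\<close> and
  \<open>V\<close> to converge to a level at which its slope is bounded away from \<open>0\<close>, which keeps \<open>dw/d\<tau>\<close>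
  away from \<open>0\<close>.\<close>

lemma collapse_threshold:
  "\<exists>\<xi>>0. \<forall>g t. phi_solution V {0..} g \<and> 0 \<le> t \<and> fst (snd (g t)) < \<xi> \<longrightarrow>
     ((\<lambda>t. fst (snd (g t))) \<longlongrightarrow> 0) at_top"
proof -
  obtain K where K: "K > 0"
    "\<And>v. v > K \<Longrightarrow> \<exists>\<epsilon>>0. \<exists>c>0. \<forall>t. \<bar>V t - v\<bar> \<le> \<epsilon> \<longrightarrow> c \<le> \<bar>deriv V t\<bar>"
    using V_steep_at_high_levels by blast
  \<comment> \<open>Since \<open>x\<close> decreases to its limit \<open>l\<close>, a value below
    \<open>1 / sqrt K\<close> yields \<open>1 / l\<^sup>2 > K\<close> if \<open>l\<close> is
    positive, which is the range where \<open>V\<close> is steep.\<close>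
  have "((\<lambda>t. fst (snd (g t))) \<longlongrightarrow> 0) at_top"
    if g0: "phi_solution V {0..} g" and T: "0 \<le> T" "fst (snd (g T)) < 1 / sqrt K" for g T
  proof -
    obtain \<phi> x w z where geq: "g = (\<lambda>t. (\<phi> t, x t, w t, z t))" by (rule tuple4_fun)
    note g = g0[unfolded geq]
    have "(x \<longlongrightarrow> 0) at_top"
    proof (cases "z 0 = 0")
      case False
      then show ?thesis by (rule x_tendsto_0_of_z_nonzero[OF g])
    next
      case True
      have z: "z t = 0" if t: "0 \<le> t" for t
      proof (rule linear_ode_continuous_bounds(1)[where a = 0 and b = t and e = z
            and k = "\<lambda>t. (1 - 3 * (w t)\<^sup>2 - (z t)\<^sup>2) / sqrt 6"])
        have g': "phi_solution V {0..t} (\<lambda>t. (\<phi> t, x t, w t, z t))"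
          by (rule phi_solution_subset[OF g]) auto
        show "(z has_real_derivative (1 - 3 * (w r)\<^sup>2 - (z r)\<^sup>2) / sqrt 6 * z r) (at r within {0..t})"
          if "r \<in> {0..t}" for r
          by (rule phi_solution_tuple(4)[OF g' that])
        have "continuous_on {0..t} w" "continuous_on {0..t} z"
          using phi_solution_tuple(3,4)[OF g'] by (meson DERIV_continuous continuous_on_eq_continuous_within)+
        then show "continuous_on {0..t} (\<lambda>t. (1 - 3 * (w t)\<^sup>2 - (z t)\<^sup>2) / sqrt 6)"
          by (intro continuous_intros) auto
      qed (use t True in auto)
      obtain l where l: "(x \<longlongrightarrow> l) at_top" "0 \<le> l" "\<And>t. 0 \<le> t \<Longrightarrow> l \<le> x t"
        using x_limit[OF g] by blast
      show ?thesis
      proof (cases "l = 0")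
        case True
        then show ?thesis using l by simp
      next
        case False
        then have lpos: "l > 0" using l by simp
        have w0: "(w \<longlongrightarrow> 0) at_top" by (rule w_tendsto_0[OF g l(1) lpos])
        have "l < 1 / sqrt K" using l(3)[OF T(1)] T(2) by (simp add: geq)
        then have "l\<^sup>2 < (1 / sqrt K)\<^sup>2" using lpos by (intro power_strict_mono) auto
        then have "K < 1 / l\<^sup>2" using lpos K(1) by (simp add: power_divide field_simps)
        from K(2)[OF this] obtain \<epsilon> c where \<epsilon>: "\<epsilon> > 0" and c: "c > 0"
          "\<And>t. \<bar>V t - 1 / l\<^sup>2\<bar> \<le> \<epsilon> \<Longrightarrow> c \<le> \<bar>deriv V t\<bar>" by blast
        \<comment> \<open>With \<open>z = 0\<close> this quotient is \<open>V\<close> by the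
          constraint, so the limits of \<open>w\<close> and \<open>x\<close> determine the limit of
          \<open>V\<close>, whether or not \<open>\<phi>\<close> converges.\<close>
        have "((\<lambda>t. (1 - (w t)\<^sup>2) / (x t)\<^sup>2) \<longlongrightarrow> (1 - 0\<^sup>2) / l\<^sup>2) at_top"
          using lpos by (intro tendsto_intros w0 l(1)) auto
        moreover have "\<forall>\<^sub>F t in at_top. (1 - (w t)\<^sup>2) / (x t)\<^sup>2 = V (\<phi> t)"
          using eventually_ge_at_top[of 0]
        proof eventually_elim
          case (elim t)
          then show ?case
            using phi_solution_global[OF g elim] z[OF elim] by (simp add: divide_eq_eq)
        qed
        ultimately have "((\<lambda>t. V (\<phi> t)) \<longlongrightarrow> 1 / l\<^sup>2) at_top"
          by (simp add: tendsto_cong)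
        then have ev1: "\<forall>\<^sub>F t in at_top. \<bar>V (\<phi> t) - 1 / l\<^sup>2\<bar> < \<epsilon>"
          using tendstoD[OF _ \<epsilon>] by (fastforce simp: dist_real_def)
        \<comment> \<open>A lower bound for the size of the potential term in the equation for
          \<open>w\<close>. The tolerances \<open>m / 2\<close> for the other term and
          \<open>m / 4\<close> for each of two values of \<open>w\<close> add up to less than
          \<open>m\<close>.\<close>
        define m where "m = 1/2 * c * l\<^sup>2"
        have m: "m > 0" using c lpos by (simp add: m_def)
        have "((\<lambda>t. sqrt (3/2) * w t * (1 - (w t)\<^sup>2)) \<longlongrightarrow> sqrt (3/2) * 0 * (1 - 0\<^sup>2)) at_top"
          by (intro tendsto_intros w0)
        from tendstoD[OF this, of "m / 2"] m
        have ev2: "\<forall>\<^sub>F t in at_top. \<bar>sqrt (3/2) * w t * (1 - (w t)\<^sup>2)\<bar> < m / 2"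
          by (simp add: dist_real_def)
        have ev3: "\<forall>\<^sub>F t in at_top. \<bar>w t\<bar> < m / 4"
          using tendstoD[OF w0, of "m / 4"] m by (simp add: dist_real_def)
        have "\<forall>\<^sub>F t in at_top. 0 < t \<and> \<bar>V (\<phi> t) - 1 / l\<^sup>2\<bar> < \<epsilon> \<and>
            \<bar>sqrt (3/2) * w t * (1 - (w t)\<^sup>2)\<bar> < m / 2 \<and> \<bar>w t\<bar> < m / 4"
          by (intro eventually_conj ev1 ev2 ev3 eventually_gt_at_top)
        then obtain t0 where t0: "\<And>t. t \<ge> t0 \<Longrightarrow> 0 < t" "\<And>t. t \<ge> t0 \<Longrightarrow> \<bar>V (\<phi> t) - 1 / l\<^sup>2\<bar> < \<epsilon>"
            "\<And>t. t \<ge> t0 \<Longrightarrow> \<bar>sqrt (3/2) * w t * (1 - (w t)\<^sup>2)\<bar> < m / 2" "\<And>t. t \<ge> t0 \<Longrightarrow> \<bar>w t\<bar> < m / 4"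
          unfolding eventually_at_top_linorder by blast
        \<comment> \<open>Over a unit of time the increment of \<open>w\<close> equals its
          derivative at some \<open>\<eta>\<close>. A small increment and a small first term cannot
          balance a potential term of size at least \<open>m\<close>.\<close>
        obtain \<eta> where \<eta>: "t0 < \<eta>" "\<eta> < t0 + 1"
          "w (t0 + 1) - w t0 = (t0 + 1 - t0) * (sqrt (3/2) * w \<eta> * (1 - (w \<eta>)\<^sup>2 - (z \<eta>)\<^sup>2 / 3)
             - 1/2 * deriv V (\<phi> \<eta>) * (x \<eta>)\<^sup>2)"
          using MVT2[of t0 "t0 + 1" w, OF _ phi_solution_deriv_at(2)[OF g]] t0(1) by auto
        have z\<eta>: "z \<eta> = 0" using z t0(1)[of \<eta>] \<eta>(1) by simp
        have "m \<le> \<bar>1/2 * deriv V (\<phi> \<eta>) * (x \<eta>)\<^sup>2\<bar>"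
          unfolding m_def abs_mult
          using c(2)[of "\<phi> \<eta>"] t0(2)[of \<eta>] t0(1)[of \<eta>] \<eta>(1) l(3)[of \<eta>] lpos c(1)
          by (intro mult_mono) (auto simp: power_mono)
        moreover have "\<bar>w (t0 + 1) - w t0\<bar> < m / 2"
          using t0(4)[of t0] t0(4)[of "t0 + 1"] abs_triangle_ineq4[of "w (t0 + 1)" "w t0"]
          by linarith
        moreover have "\<bar>sqrt (3/2) * w \<eta> * (1 - (w \<eta>)\<^sup>2)\<bar> < m / 2"
          using t0(3) \<eta>(1) by simp
        moreover have "w (t0 + 1) - w t0 = sqrt (3/2) * w \<eta> * (1 - (w \<eta>)\<^sup>2)
             - 1/2 * deriv V (\<phi> \<eta>) * (x \<eta>)\<^sup>2"
          using \<eta>(3) unfolding z\<eta> by simp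
        ultimately show ?thesis by linarith
      qed
    qed
    then show ?thesis by (simp add: geq)
  qed
  moreover have "1 / sqrt K > 0" using K by simp
  ultimately show ?thesis by blast
qed

end

subsection \<open>Genericity of collapse\<close>

text \<open>A bounded trajectory staying \<open>\<epsilon>\<close> away from \<open>M\<close> along
  a sequence of times would have a limit point outside \<open>M\<close>. Boundedness also supplies
  one limit point, hence the nonemptiness contained in \<open>approaches\<close>.\<close>

lemma approaches_of_limit_points:
  fixes \<gamma> :: "real \<Rightarrow> 'a::heine_borel"
  assumes bd: "bounded (\<gamma> ` {0..})"
    and lim: "\<And>q \<sigma>. \<lbrakk>filterlim \<sigma> at_top sequentially; (\<lambda>n. \<gamma> (\<sigma> n)) \<longlonglongrightarrow> q\<rbrakk> \<Longrightarrow> q \<in> M"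
  shows "approaches \<gamma> M"
proof -
  have sub: "\<exists>q r. strict_mono r \<and> (\<lambda>n. \<gamma> (\<sigma> (r n))) \<longlonglongrightarrow> q \<and> q \<in> M"
    if \<sigma>: "\<And>n. real n \<le> \<sigma> n" for \<sigma> :: "nat \<Rightarrow> real"
  proof -
    have "range (\<lambda>n. \<gamma> (\<sigma> n)) \<subseteq> \<gamma> ` {0..}"
      using \<sigma> by (force intro: order_trans[OF of_nat_0_le_iff])
    then obtain q r where r: "strict_mono r" "((\<lambda>n. \<gamma> (\<sigma> n)) \<circ> r) \<longlonglongrightarrow> q"
      using bounded_imp_convergent_subsequence[OF bounded_subset[OF bd]] by blast
    have "filterlim \<sigma> at_top sequentially"
      by (rule filterlim_at_top_mono[OF filterlim_real_sequentially]) (simp add: \<sigma>)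
    then have "filterlim (\<lambda>n. \<sigma> (r n)) at_top sequentially"
      using filterlim_subseq[OF r(1)] by (rule filterlim_compose)
    with r lim show ?thesis by (auto simp: o_def)
  qed
  have "M \<noteq> {}" using sub[of real] by auto
  moreover have "((\<lambda>t. infdist (\<gamma> t) M) \<longlongrightarrow> 0) at_top"
  proof (rule ccontr)
    assume "\<not> ?thesis"
    then obtain \<epsilon> where \<epsilon>: "\<epsilon> > 0" "\<not> (\<forall>\<^sub>F t in at_top. dist (infdist (\<gamma> t) M) 0 < \<epsilon>)"
      by (auto simp: tendsto_iff)
    have "\<exists>t\<ge>real n. \<epsilon> \<le> infdist (\<gamma> t) M" for n
      using \<epsilon>(2) by (auto simp: eventually_at_top_linorder infdist_nonneg not_less)
    then obtain \<sigma> where \<sigma>: "\<And>n. real n \<le> \<sigma> n" "\<And>n. \<epsilon> \<le> infdist (\<gamma> (\<sigma> n)) M" by metis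
    obtain q r where r: "strict_mono r" "(\<lambda>n. \<gamma> (\<sigma> (r n))) \<longlonglongrightarrow> q" "q \<in> M"
      using sub[OF \<sigma>(1)] by blast
    have "(\<lambda>n. infdist (\<gamma> (\<sigma> (r n))) M) \<longlonglongrightarrow> infdist q M"
      by (rule tendsto_infdist[OF r(2)])
    then have "\<epsilon> \<le> infdist q M"
      by (rule tendsto_lowerbound) (use \<sigma>(2) in auto)
    then show False using r(3) \<epsilon>(1) by simp
  qed
  ultimately show ?thesis by (simp add: approaches_def)
qed

lemma generically_cong:
  assumes "\<And>p. p \<in> A \<Longrightarrow> P p \<longleftrightarrow> Q p"
  shows "generically A P \<longleftrightarrow> generically A Q"
proof -
  have "{p \<in> A. P p} = {p \<in> A. Q p}" using assms by blast
  then show ?thesis by (simp add: generically_def)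
qed

context compactified_potential
begin

section \<open>Maximal solutions and their limit points\<close>

lemma collapsing_field_exists:
  assumes p: "p \<in> admissible f V"
  shows "\<exists>\<gamma>. collapsing_field f V \<psi> \<infinity> \<gamma> \<and> \<gamma> 0 = p"
proof -
  obtain C where C: "0 \<le> C" "\<And>t. - C \<le> V t" using V_bounded_below by blast
  obtain g where g: "g 0 = to_phi p" "phi_solution V {0..} g"
    using phi_solution_exists[OF C2_V C to_phi_admissible[OF p]] by blast
  have "from_phi (g 0) = p"
    unfolding g(1) using p by (intro from_phi_to_phi) (auto simp: admissible_def)
  \<comment> \<open>Maximality is automatic, since no \<open>T'\<close> exceeds
    \<open>\<infinity>\<close>.\<close>
  moreover have "collapsing_field f V \<psi> \<infinity> (\<lambda>t. from_phi (g t))"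
    using phi_solution_from_phi[OF g(2)] p calculation by (simp add: collapsing_field_def)
  ultimately show ?thesis by blast
qed

text \<open>The global solution in \<open>\<phi>\<close> with the same initial value agrees with
  \<open>\<gamma>\<close> by uniqueness and thus extends it, so maximality forces
  \<open>T = \<infinity>\<close>.\<close>

lemma collapsing_field_phi:
  assumes "collapsing_field f V \<psi> T \<gamma>"
  shows "T = \<infinity>" "\<exists>g. phi_solution V {0..} g \<and> g 0 = to_phi (\<gamma> 0) \<and> (\<forall>t\<ge>0. \<gamma> t = from_phi (g t))"
proof -
  have sol: "constrained_solution_on f V \<psi> T \<gamma>" and init: "\<gamma> 0 \<in> admissible f V"
    and maximal: "\<And>T' \<eta>. \<lbrakk>T \<le> T'; constrained_solution_on f V \<psi> T' \<eta>;
      \<And>t. 0 \<le> t \<Longrightarrow> ereal t < T \<Longrightarrow> \<eta> t = \<gamma> t\<rbrakk> \<Longrightarrow> T' = T"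
    using assms by (auto simp: collapsing_field_def)
  obtain C where C: "0 \<le> C" "\<And>t. - C \<le> V t" using V_bounded_below by blast
  obtain g where g: "g 0 = to_phi (\<gamma> 0)" "phi_solution V {0..} g"
    using phi_solution_exists[OF C2_V C to_phi_admissible[OF init]] by blast
  have eq: "from_phi (g t) = \<gamma> t" if t: "0 \<le> t" "ereal t < T" for t
  proof -
    have "phi_solution V {0..t} g" by (rule phi_solution_subset[OF g(2)]) auto
    then have "to_phi (\<gamma> t) = g t"
      using phi_solution_unique[OF C2_V C constrained_solution_to_phi(1)[OF sol init t], of g t] g(1) t
      by simp
    then show ?thesis using constrained_solution_to_phi(2)[OF sol init t] by simp
  qed
  show "T = \<infinity>"
    using maximal[OF _ phi_solution_from_phi[OF g(2)] eq] by simp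
  then show "\<exists>g. phi_solution V {0..} g \<and> g 0 = to_phi (\<gamma> 0) \<and> (\<forall>t\<ge>0. \<gamma> t = from_phi (g t))"
    using g eq by auto
qed

lemma Omega_iff: "p \<in> Omega f V b \<longleftrightarrow> p \<in> admissible f V \<and> fst (snd p) \<le> b"
  by (auto simp: Omega_def admissible_def)

lemma x_from_phi [simp]: "fst (snd (from_phi p)) = fst (snd p)"
  and x_to_phi [simp]: "fst (snd (to_phi p)) = fst (snd p)"
  by (simp_all add: from_phi_def to_phi_def split: prod.split)

lemma phi_solution_Omega:
  assumes g: "phi_solution V {0..} g" and b: "fst (snd (g 0)) \<le> b" and t: "0 \<le> t"
  shows "from_phi (g t) \<in> Omega f V b"
proof -
  obtain \<phi> x w z where geq: "g = (\<lambda>t. (\<phi> t, x t, w t, z t))" by (rule tuple4_fun)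
  have "x t \<le> x 0" by (rule phi_solution_antimono[OF g[unfolded geq]]) (use t in auto)
  then show ?thesis
    using from_phi_admissible[OF phi_solution_admissible[OF g t]] b by (simp add: Omega_iff geq)
qed

text \<open>If the limit has \<open>\<bar>s\<bar> < 1\<close>, then \<open>V (inv f s)\<close> is
  continuous there, \<open>V * x\<^sup>2\<close> tends to 0 and the constraint leaves
  \<open>w\<^sup>2 + z\<^sup>2 = 1\<close>. Otherwise \<open>\<bar>s\<bar> = 1\<close>, where
  \<open>V\<close> may blow up and nothing more is required.\<close>

lemma limit_point_in_M:
  assumes \<Omega>: "\<forall>\<^sub>F n in F. p n \<in> Omega f V b" and F: "F \<noteq> bot"
    and q: "(p \<longlongrightarrow> q) F" and x0: "((\<lambda>n. fst (snd (p n))) \<longlongrightarrow> 0) F"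
  shows "q \<in> M_minus1 f V b"
proof -
  obtain s x w z where qeq: "q = (s, x, w, z)" by (cases q) auto
  have cl: "q \<in> closure (Omega f V b)"
  proof (rule Lim_in_closed_set[OF closed_closure _ F q])
    show "\<forall>\<^sub>F n in F. p n \<in> closure (Omega f V b)"
      using \<Omega> by eventually_elim (rule subsetD[OF closure_subset])
  qed
  note L = tendsto_fst[OF q] tendsto_fst[OF tendsto_snd[OF q]]
    tendsto_fst[OF tendsto_snd[OF tendsto_snd[OF q]]] tendsto_snd[OF tendsto_snd[OF tendsto_snd[OF q]]]
  have x: "x = 0" using tendsto_unique[OF F L(2) x0] by (simp add: qeq)
  have "((\<lambda>n. \<bar>fst (p n)\<bar>) \<longlongrightarrow> \<bar>s\<bar>) F"
    using tendsto_rabs[OF L(1)] by (simp add: qeq)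
  then have "\<bar>s\<bar> \<le> 1"
    by (rule tendsto_upperbound[OF _ _ F])
      (use \<Omega> in \<open>auto simp: Omega_def elim!: eventually_mono\<close>)
  moreover have "w\<^sup>2 + z\<^sup>2 = 1" if s: "\<bar>s\<bar> < 1"
  proof -
    have "isCont (\<lambda>s. V (inv f s)) s"
      by (rule isCont_o2[OF isCont_inv_f[OF s] DERIV_isCont[OF C2_realD(1)[OF C2_V]]])
    then have "((\<lambda>n. V (inv f (fst (p n)))) \<longlongrightarrow> V (inv f s)) F"
      using isCont_tendsto_compose[of s "\<lambda>s. V (inv f s)"] L(1) by (simp add: qeq)
    then have "((\<lambda>n. V (inv f (fst (p n))) * (fst (snd (p n)))\<^sup>2 + (fst (snd (snd (p n))))\<^sup>2
        + (snd (snd (snd (p n))))\<^sup>2) \<longlongrightarrow> V (inv f s) * 0\<^sup>2 + w\<^sup>2 + z\<^sup>2) F"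
      using L(3,4) by (intro tendsto_intros x0) (simp_all add: qeq)
    moreover have "((\<lambda>n. V (inv f (fst (p n))) * (fst (snd (p n)))\<^sup>2 + (fst (snd (snd (p n))))\<^sup>2
        + (snd (snd (snd (p n))))\<^sup>2) \<longlongrightarrow> 1) F"
      by (rule tendsto_eventually) (use \<Omega> in \<open>auto simp: Omega_def elim!: eventually_mono\<close>)
    ultimately have "V (inv f s) * 0\<^sup>2 + w\<^sup>2 + z\<^sup>2 = 1" by (rule tendsto_unique[OF F])
    then show ?thesis by simp
  qed
  ultimately have "\<bar>s\<bar> = 1 \<or> w\<^sup>2 + z\<^sup>2 = 1" by linarith
  then show ?thesis using cl x by (auto simp: M_minus1_def qeq)
qed

text \<open>On \<open>M_minus1\<close> the coordinate \<open>x\<close> vanishes and projections do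
  not increase distances, so \<open>x\<close> is at most the distance to the set. The converse is
  compactness: limit points of a trajectory with \<open>x\<close> tending to 0 lie in
  \<open>M_minus1\<close>.\<close>

lemma approaches_M_iff:
  assumes col: "collapsing_field f V \<psi> T \<gamma>" and \<Omega>: "\<gamma> 0 \<in> Omega f V b"
  shows "approaches \<gamma> (M_minus1 f V b) \<longleftrightarrow> ((\<lambda>t. fst (snd (\<gamma> t))) \<longlongrightarrow> 0) at_top"
proof
  assume A: "approaches \<gamma> (M_minus1 f V b)"
  have "norm (fst (snd (\<gamma> t))) \<le> infdist (\<gamma> t) (M_minus1 f V b)" for t
  proof -
    have "norm (fst (snd (\<gamma> t))) \<le> dist (\<gamma> t) a" if "a \<in> M_minus1 f V b" for a
    proof -
      have "fst (snd a) = 0" using that by (auto simp: M_minus1_def)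
      then have "norm (fst (snd (\<gamma> t))) = dist (fst (snd (\<gamma> t))) (fst (snd a))" by simp
      also have "\<dots> \<le> dist (\<gamma> t) a"
        by (rule order_trans[OF dist_fst_le dist_snd_le])
      finally show ?thesis .
    qed
    then show ?thesis
      using A unfolding approaches_def by (auto simp: infdist_notempty intro: cINF_greatest)
  qed
  then have ev: "\<forall>\<^sub>F t in at_top. norm (fst (snd (\<gamma> t))) \<le> infdist (\<gamma> t) (M_minus1 f V b)"
    by (intro always_eventually allI)
  show "((\<lambda>t. fst (snd (\<gamma> t))) \<longlongrightarrow> 0) at_top"
    using A Lim_null_comparison[OF ev] unfolding approaches_def by blast
next
  assume x0: "((\<lambda>t. fst (snd (\<gamma> t))) \<longlongrightarrow> 0) at_top"
  obtain g where g: "phi_solution V {0..} g" "g 0 = to_phi (\<gamma> 0)" "\<And>t. 0 \<le> t \<Longrightarrow> \<gamma> t = from_phi (g t)"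
    using collapsing_field_phi(2)[OF col] by blast
  have b: "fst (snd (g 0)) \<le> b" using \<Omega> by (simp add: g(2) Omega_iff)
  have in\<Omega>: "\<gamma> t \<in> Omega f V b" if "0 \<le> t" for t
    using phi_solution_Omega[OF g(1) b that] g(3)[OF that] by simp
  show "approaches \<gamma> (M_minus1 f V b)"
  proof (rule approaches_of_limit_points)
    obtain \<phi> x w z where geq: "g = (\<lambda>t. (\<phi> t, x t, w t, z t))" by (rule tuple4_fun)
    obtain B where B: "\<And>t. 0 \<le> t \<Longrightarrow> \<bar>w t\<bar> \<le> B" "\<And>t. 0 \<le> t \<Longrightarrow> \<bar>z t\<bar> \<le> B"
      using phi_solution_global_bounds[OF g(1)[unfolded geq]] by blast
    have "\<gamma> ` {0..} \<subseteq> cube (1 + b + B)"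
    proof (rule image_subsetI)
      fix t :: real assume "t \<in> {0..}"
      then have t: "0 \<le> t" by simp
      have "0 < x t" "x t \<le> b"
        using in\<Omega>[OF t] g(3)[OF t] by (auto simp: geq from_phi_def Omega_def)
      then have "(f (\<phi> t), x t, w t, z t) \<in> cube (1 + b + B)"
        using B[OF t] f_abs[of "\<phi> t"] by (auto simp: mem_cube)
      then show "\<gamma> t \<in> cube (1 + b + B)" using g(3)[OF t] by (simp add: geq from_phi_def)
    qed
    then show "bounded (\<gamma> ` {0..})"
      using bounded_cbox bounded_subset unfolding cube_def by blast
    fix q \<sigma> assume \<sigma>: "filterlim \<sigma> at_top sequentially" "(\<lambda>n. \<gamma> (\<sigma> n)) \<longlonglongrightarrow> q"
    have "\<forall>\<^sub>F n in sequentially. 0 \<le> \<sigma> n" using \<sigma>(1) by (simp add: filterlim_at_top)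
    then have "\<forall>\<^sub>F n in sequentially. \<gamma> (\<sigma> n) \<in> Omega f V b"
      by eventually_elim (rule in\<Omega>)
    then show "q \<in> M_minus1 f V b"
      using \<sigma>(2) filterlim_compose[OF x0 \<sigma>(1)] by (intro limit_point_in_M) auto
  qed
qed

lemma x_tendsto_at_right_iff:
  assumes col: "collapsing_field f V \<psi> T \<gamma>"
  shows "filterlim (\<lambda>t. fst (snd (\<gamma> t))) (at_right 0) at_top \<longleftrightarrow> ((\<lambda>t. fst (snd (\<gamma> t))) \<longlongrightarrow> 0) at_top"
proof -
  obtain g where g: "phi_solution V {0..} g" "\<And>t. 0 \<le> t \<Longrightarrow> \<gamma> t = from_phi (g t)"
    using collapsing_field_phi(2)[OF col] by blast
  have "\<forall>\<^sub>F t in at_top. 0 < fst (snd (\<gamma> t))"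
    using eventually_ge_at_top[of 0]
  proof eventually_elim
    case (elim t)
    show ?case
      using phi_solution_admissible[OF g(1) elim]
      by (cases "g t") (simp add: g(2)[OF elim] phi_admissible_def)
  qed
  then have "\<forall>\<^sub>F t in at_top. fst (snd (\<gamma> t)) \<in> {0<..} \<and> fst (snd (\<gamma> t)) \<noteq> 0"
    by eventually_elim auto
  then show ?thesis by (simp add: filterlim_at)
qed

section \<open>Openness and density of the collapsing data\<close>

definition collapses :: "state \<Rightarrow> bool" where
  "collapses p \<longleftrightarrow> (\<forall>T \<gamma>. collapsing_field f V \<psi> T \<gamma> \<and> \<gamma> 0 = p \<longrightarrow>
     ((\<lambda>t. fst (snd (\<gamma> t))) \<longlongrightarrow> 0) at_top)"

lemma collapsesI:
  assumes "\<And>g. phi_solution V {0..} g \<Longrightarrow> g 0 = to_phi p \<Longrightarrow> ((\<lambda>t. fst (snd (g t))) \<longlongrightarrow> 0) at_top"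
  shows "collapses p"
  unfolding collapses_def
proof (intro allI impI)
  fix T \<gamma> assume "collapsing_field f V \<psi> T \<gamma> \<and> \<gamma> 0 = p"
  then obtain g where g: "phi_solution V {0..} g" "g 0 = to_phi p" "\<And>t. 0 \<le> t \<Longrightarrow> \<gamma> t = from_phi (g t)"
    using collapsing_field_phi(2) by blast
  have "\<forall>\<^sub>F t in at_top. fst (snd (\<gamma> t)) = fst (snd (g t))"
    using eventually_ge_at_top[of 0] by eventually_elim (simp add: g(3))
  then show "((\<lambda>t. fst (snd (\<gamma> t))) \<longlongrightarrow> 0) at_top"
    using assms[OF g(1,2)] by (simp add: tendsto_cong)
qed

lemma collapses_of_z_nonzero:
  assumes "snd (snd (snd p)) \<noteq> 0"
  shows "collapses p"
proof (rule collapsesI)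
  fix g assume g: "phi_solution V {0..} g" "g 0 = to_phi p"
  obtain \<phi> x w z where geq: "g = (\<lambda>t. (\<phi> t, x t, w t, z t))" by (rule tuple4_fun)
  have "z 0 \<noteq> 0" using assms g(2) by (auto simp: geq to_phi_def split: prod.splits)
  from x_tendsto_0_of_z_nonzero[OF g(1)[unfolded geq] this]
  show "((\<lambda>t. fst (snd (g t))) \<longlongrightarrow> 0) at_top" by (simp add: geq)
qed

lemma isCont_to_phi:
  assumes "\<bar>fst p\<bar> < 1"
  shows "isCont to_phi p"
proof -
  have "to_phi = (\<lambda>p. (inv f (fst p), snd p))"
    by (auto simp: to_phi_def fun_eq_iff)
  moreover have "isCont (\<lambda>p :: state. inv f (fst p)) p"
    by (rule isCont_o2[OF continuous_fst[OF continuous_ident] isCont_inv_f[OF assms]])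
  ultimately show ?thesis by (simp add: continuous_intros)
qed

lemma collapses_open:
  "openin (top_of_set (Omega f V b)) {p \<in> Omega f V b. collapses p}"
  unfolding openin_euclidean_subtopology_iff
proof (intro conjI ballI)
  fix p assume "p \<in> {p \<in> Omega f V b. collapses p}"
  then have p: "p \<in> Omega f V b" "collapses p" by auto
  then have padm: "p \<in> admissible f V" and pb: "fst (snd p) \<le> b" by (auto simp: Omega_iff)
  obtain \<gamma> where \<gamma>: "collapsing_field f V \<psi> \<infinity> \<gamma>" "\<gamma> 0 = p"
    using collapsing_field_exists[OF padm] by blast
  obtain g where g: "phi_solution V {0..} g" "g 0 = to_phi p" "\<And>t. 0 \<le> t \<Longrightarrow> \<gamma> t = from_phi (g t)"
    using collapsing_field_phi(2)[OF \<gamma>(1)] \<gamma>(2) by blast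
  have x0: "((\<lambda>t. fst (snd (\<gamma> t))) \<longlongrightarrow> 0) at_top" using p(2) \<gamma> by (auto simp: collapses_def)
  obtain \<xi> where \<xi>: "\<xi> > 0"
    "\<forall>g t. phi_solution V {0..} g \<and> 0 \<le> t \<and> fst (snd (g t)) < \<xi> \<longrightarrow>
      ((\<lambda>t. fst (snd (g t))) \<longlongrightarrow> 0) at_top"
    using collapse_threshold by blast
  have "\<forall>\<^sub>F t in at_top. 0 \<le> t \<and> fst (snd (\<gamma> t)) < \<xi>"
    by (intro eventually_conj eventually_ge_at_top order_tendstoD(2)[OF x0 \<xi>(1)])
  then obtain T where T: "0 \<le> T" "fst (snd (\<gamma> T)) < \<xi>"
    by (auto simp: eventually_at_top_linorder)
  \<comment> \<open>The slack by which the reference solution is below the threshold at time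
    \<open>T\<close>; neighbours may differ by less than this.\<close>
  define \<eta> where "\<eta> = \<xi> - fst (snd (g T))"
  have \<eta>: "\<eta> > 0" using T by (simp add: \<eta>_def g(3))
  obtain C where C: "0 \<le> C" "\<And>t. - C \<le> V t" using V_bounded_below by blast
  obtain L where L: "\<forall>g h. phi_solution V {0..T} g \<and> phi_solution V {0..T} h \<and>
       \<bar>fst (g 0)\<bar> \<le> \<bar>fst (to_phi p)\<bar> + 1 \<and> fst (snd (g 0)) \<le> b \<and>
       \<bar>fst (h 0)\<bar> \<le> \<bar>fst (to_phi p)\<bar> + 1 \<and> fst (snd (h 0)) \<le> b \<longrightarrow>
       (\<forall>t\<in>{0..T}. dist (g t) (h t) \<le> exp (L * t) * dist (g 0) (h 0))"
    using phi_solution_dependence[OF C2_V C, of T "\<bar>fst (to_phi p)\<bar> + 1" b] by blast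
  \<comment> \<open>A radius in the coordinate \<open>\<phi>\<close>. The bound 1 keeps nearby data
    within the range where \<open>L\<close> is valid, and \<open>exp (- (L * T))\<close> compensates
    the growth of distances up to \<open>T\<close>.\<close>
  define r where "r = min 1 (\<eta> * exp (- (L * T)))"
  have r: "r > 0" using \<eta> by (simp add: r_def)
  have "isCont to_phi p" using padm by (intro isCont_to_phi) (auto simp: admissible_def)
  then obtain d where d: "d > 0" "\<And>p'. dist p' p < d \<Longrightarrow> dist (to_phi p') (to_phi p) < r"
    using r by (auto simp: continuous_at_eps_delta)
  have "p' \<in> {p \<in> Omega f V b. collapses p}" if p': "p' \<in> Omega f V b" "dist p' p < d" for p'
  proof -
    have close: "dist (to_phi p') (to_phi p) < r" using d(2) p'(2) by blast
    have "collapses p'"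
    proof (rule collapsesI)
      fix h assume h: "phi_solution V {0..} h" "h 0 = to_phi p'"
      have "dist (fst (h 0)) (fst (to_phi p)) < 1"
        using close dist_fst_le[of "h 0" "to_phi p"] by (simp add: h(2) r_def)
      then have "\<bar>fst (h 0)\<bar> \<le> \<bar>fst (to_phi p)\<bar> + 1" by (simp add: dist_real_def)
      moreover have "phi_solution V {0..T} h" "phi_solution V {0..T} g"
        by (rule phi_solution_subset[OF h(1)] phi_solution_subset[OF g(1)], simp)+
      ultimately have "dist (h T) (g T) \<le> exp (L * T) * dist (h 0) (g 0)"
        using L[rule_format, of h g T] p'(1) pb T(1) by (simp add: g(2) h(2) Omega_iff)
      also have "\<dots> < exp (L * T) * (\<eta> * exp (- (L * T)))"
        using close by (simp add: g(2) h(2) r_def)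
      also have "\<dots> = \<eta>" by (simp add: exp_minus)
      finally have "dist (h T) (g T) < \<eta>" .
      moreover have "dist (fst (snd (h T))) (fst (snd (g T))) \<le> dist (h T) (g T)"
        by (rule order_trans[OF dist_fst_le dist_snd_le])
      ultimately have "fst (snd (h T)) < \<xi>" by (simp add: \<eta>_def dist_real_def)
      then show "((\<lambda>t. fst (snd (h t))) \<longlongrightarrow> 0) at_top" using \<xi>(2) h(1) T(1) by blast
    qed
    then show ?thesis using p'(1) by simp
  qed
  then show "\<exists>e>0. \<forall>x'\<in>Omega f V b. dist x' p < e \<longrightarrow> x' \<in> {p \<in> Omega f V b. collapses p}"
    using d(1) by blast
qed auto

text \<open>Data with \<open>z = 0\<close> are joined to data with \<open>z \<noteq> 0\<close> by a
  path inside \<open>Omega\<close>. The constraint must be rebalanced without raising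
  \<open>x\<close>, since \<open>x = b\<close> is allowed.\<close>

lemma collapses_dense: "Omega f V b \<subseteq> closure {p \<in> Omega f V b. collapses p}"
proof
  fix p assume p: "p \<in> Omega f V b"
  let ?S = "{p \<in> Omega f V b. collapses p}"
  obtain s x w z where peq: "p = (s, x, w, z)" by (cases p) auto
  have P: "-1 < s" "s < 1" "0 < x" "x \<le> b" "V (inv f s) * x\<^sup>2 + w\<^sup>2 + z\<^sup>2 = 1"
    using p by (auto simp: peq Omega_def)
  have path: "p \<in> closure ?S"
    if "(h \<longlongrightarrow> p) (at_right 0)" "\<forall>\<^sub>F \<epsilon> in at_right 0. h \<epsilon> \<in> Omega f V b \<and> snd (snd (snd (h \<epsilon>))) \<noteq> 0"
    for h :: "real \<Rightarrow> state"
  proof (rule Lim_in_closed_set[OF closed_closure _ _ that(1)])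
    show "\<forall>\<^sub>F \<epsilon> in at_right 0. h \<epsilon> \<in> closure ?S"
      using that(2)
    proof eventually_elim
      case (elim \<epsilon>)
      then have "h \<epsilon> \<in> ?S" using collapses_of_z_nonzero by simp
      then show ?case by (rule subsetD[OF closure_subset])
    qed
  qed simp
  consider "z \<noteq> 0" | "z = 0" "w \<noteq> 0" | "z = 0" "w = 0" by blast
  then show "p \<in> closure ?S"
  proof cases
    case 1
    then have "p \<in> ?S" using p collapses_of_z_nonzero by (simp add: peq)
    then show ?thesis by (rule subsetD[OF closure_subset])
  next
    \<comment> \<open>Part of \<open>w\<^sup>2\<close> is traded for \<open>z\<^sup>2\<close> with
      \<open>s\<close> and \<open>x\<close> fixed; \<open>sgn w\<close> keeps the path on the right
      branch of the square root.\<close>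
    case 2
    show ?thesis
    proof (rule path)
      have "((\<lambda>\<epsilon>. (s, x, sgn w * sqrt (w\<^sup>2 - \<epsilon>\<^sup>2), \<epsilon>)) \<longlongrightarrow> (s, x, sgn w * sqrt (w\<^sup>2 - 0\<^sup>2), 0)) (at_right 0)"
        by (intro tendsto_intros)
      then show "((\<lambda>\<epsilon>. (s, x, sgn w * sqrt (w\<^sup>2 - \<epsilon>\<^sup>2), \<epsilon>)) \<longlongrightarrow> p) (at_right 0)"
        using 2 by (simp add: peq sgn_mult_abs)
      have "\<forall>\<^sub>F \<epsilon> in at_right 0. 0 < \<epsilon> \<and> \<epsilon> < \<bar>w\<bar>"
        using 2 by (auto simp: eventually_at_right_field intro!: exI[of _ "\<bar>w\<bar>"])
      then show "\<forall>\<^sub>F \<epsilon> in at_right 0. (s, x, sgn w * sqrt (w\<^sup>2 - \<epsilon>\<^sup>2), \<epsilon>) \<in> Omega f V b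
          \<and> snd (snd (snd (s, x, sgn w * sqrt (w\<^sup>2 - \<epsilon>\<^sup>2), \<epsilon>))) \<noteq> 0"
      proof eventually_elim
        case (elim \<epsilon>)
        then have "\<epsilon>\<^sup>2 \<le> w\<^sup>2" by (simp flip: abs_le_square_iff)
        moreover have "(sgn w)\<^sup>2 = 1" using 2 by (simp add: sgn_if)
        ultimately have "(sgn w * sqrt (w\<^sup>2 - \<epsilon>\<^sup>2))\<^sup>2 = w\<^sup>2 - \<epsilon>\<^sup>2"
          by (simp add: power_mult_distrib)
        then show ?case using P 2 elim by (simp add: Omega_def)
      qed
    qed
  next
    \<comment> \<open>Nothing can be taken from \<open>w\<close>, but the constraint now reads
      \<open>V * x\<^sup>2 = 1\<close>, so \<open>V > 0\<close> and lowering \<open>x\<close> makes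
      room for \<open>z\<close>.\<close>
    case 3
    then have Vx: "V (inv f s) * x\<^sup>2 = 1" using P by simp
    show ?thesis
    proof (rule path)
      have "((\<lambda>\<epsilon>. (s, x * (1 - \<epsilon>), w, sqrt (1 - (1 - \<epsilon>)\<^sup>2))) \<longlongrightarrow> (s, x * (1 - 0), w, sqrt (1 - (1 - 0)\<^sup>2))) (at_right 0)"
        by (intro tendsto_intros)
      then show "((\<lambda>\<epsilon>. (s, x * (1 - \<epsilon>), w, sqrt (1 - (1 - \<epsilon>)\<^sup>2))) \<longlongrightarrow> p) (at_right 0)"
        using 3 by (simp add: peq)
      have "\<forall>\<^sub>F \<epsilon> in at_right 0. 0 < \<epsilon> \<and> \<epsilon> < (1::real)"
        by (auto simp: eventually_at_right_field intro!: exI[of _ 1])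
      then show "\<forall>\<^sub>F \<epsilon> in at_right 0. (s, x * (1 - \<epsilon>), w, sqrt (1 - (1 - \<epsilon>)\<^sup>2)) \<in> Omega f V b
          \<and> snd (snd (snd (s, x * (1 - \<epsilon>), w, sqrt (1 - (1 - \<epsilon>)\<^sup>2)))) \<noteq> 0"
      proof eventually_elim
        case (elim \<epsilon>)
        have lt: "(1 - \<epsilon>)\<^sup>2 < 1" using elim by (intro power_less_one_iff[THEN iffD2]) auto
        have "V (inv f s) * (x * (1 - \<epsilon>))\<^sup>2 = (V (inv f s) * x\<^sup>2) * (1 - \<epsilon>)\<^sup>2"
          by (simp add: power_mult_distrib)
        then have "V (inv f s) * (x * (1 - \<epsilon>))\<^sup>2 = (1 - \<epsilon>)\<^sup>2" by (simp add: Vx)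
        moreover have "0 < x * \<epsilon>" using elim P(3) by simp
        then have "x * (1 - \<epsilon>) \<le> b" using P(4) by (simp add: algebra_simps)
        ultimately show ?case using P 3 elim lt by (simp add: Omega_def)
      qed
    qed
  qed
qed

lemma generically_collapses: "generically (Omega f V b) collapses"
  using collapses_open collapses_dense by (simp add: generically_def)

end

theorem theorem4p2:
  fixes f V \<psi> :: "real \<Rightarrow> real" and \<delta> xbar :: real
  assumes "compactification f"
    and "assumption_V f V"
    and "cutoff f V \<delta> \<psi>"
    and "xbar > 0"
  shows
    "(cutoff_regular f V \<psi> \<longrightarrow>
        (\<forall>T \<gamma>. 0 < T \<and> solution_on f V \<psi> T \<gamma> \<and> \<gamma> 0 \<in> admissible f V \<longrightarrow>
           (\<forall>\<tau>. 0 \<le> \<tau> \<and> ereal \<tau> < T \<longrightarrow> \<gamma> \<tau> \<in> admissible f V))) \<and>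
     (\<forall>p \<in> Omega f V xbar. \<exists>T \<gamma>. collapsing_field f V \<psi> T \<gamma> \<and> \<gamma> 0 = p) \<and>
     (\<forall>T \<gamma>. collapsing_field f V \<psi> T \<gamma> \<and> \<gamma> 0 \<in> Omega f V xbar \<longrightarrow>
        T = \<infinity> \<and> (\<forall>\<tau>\<ge>0. \<gamma> \<tau> \<in> Omega f V xbar)) \<and>
     M_minus1 f V xbar \<subseteq> closure (Omega f V xbar) - Omega f V xbar \<and>
     generically (Omega f V xbar)
       (\<lambda>p. \<forall>T \<gamma>. collapsing_field f V \<psi> T \<gamma> \<and> \<gamma> 0 = p \<longrightarrow>
          approaches \<gamma> (M_minus1 f V xbar)) \<and>
     generically (Omega f V xbar)
       (\<lambda>p. \<forall>T \<gamma>. collapsing_field f V \<psi> T \<gamma> \<and> \<gamma> 0 = p \<longrightarrow>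
          filterlim (\<lambda>\<tau>. fst (snd (\<gamma> \<tau>))) (at_right 0) at_top)"
proof -
  interpret compactified_potential f V \<psi> \<delta> by unfold_locales (fact assms)+
  have invariant: "T = \<infinity> \<and> (\<forall>\<tau>\<ge>0. \<gamma> \<tau> \<in> Omega f V xbar)"
    if col: "collapsing_field f V \<psi> T \<gamma>" and \<Omega>: "\<gamma> 0 \<in> Omega f V xbar" for T \<gamma>
  proof -
    obtain g where g: "phi_solution V {0..} g" "g 0 = to_phi (\<gamma> 0)" "\<And>t. 0 \<le> t \<Longrightarrow> \<gamma> t = from_phi (g t)"
      using collapsing_field_phi(2)[OF col] by blast
    have "fst (snd (g 0)) \<le> xbar" using \<Omega> by (simp add: g(2) Omega_iff)
    then show ?thesis
      using collapsing_field_phi(1)[OF col] phi_solution_Omega[OF g(1)] g(3) by simp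
  qed
  \<comment> \<open>For data in \<open>Omega\<close> both generic properties are pointwise
    equivalent to \<open>collapses\<close>, so openness and density are needed only for that
    predicate.\<close>
  have "generically (Omega f V xbar)
       (\<lambda>p. \<forall>T \<gamma>. collapsing_field f V \<psi> T \<gamma> \<and> \<gamma> 0 = p \<longrightarrow> approaches \<gamma> (M_minus1 f V xbar))
     \<longleftrightarrow> generically (Omega f V xbar) collapses"
    unfolding collapses_def by (rule generically_cong) (use approaches_M_iff in blast)
  moreover have "generically (Omega f V xbar)
       (\<lambda>p. \<forall>T \<gamma>. collapsing_field f V \<psi> T \<gamma> \<and> \<gamma> 0 = p \<longrightarrow>
          filterlim (\<lambda>\<tau>. fst (snd (\<gamma> \<tau>))) (at_right 0) at_top)
     \<longleftrightarrow> generically (Omega f V xbar) collapses"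
    unfolding collapses_def by (rule generically_cong) (use x_tendsto_at_right_iff in blast)
  moreover have "M_minus1 f V xbar \<subseteq> closure (Omega f V xbar) - Omega f V xbar"
    by (auto simp: M_minus1_def Omega_def)
  moreover have "\<exists>T \<gamma>. collapsing_field f V \<psi> T \<gamma> \<and> \<gamma> 0 = p" if "p \<in> Omega f V xbar" for p
    using collapsing_field_exists[of p] that unfolding Omega_iff by blast
  ultimately show ?thesis
    using admissible_invariant invariant generically_collapses by blast
qed

end
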